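(* Let $A$ be a Loday-type algebra and let $M$ be a representation of $A$. There is a bijection $H^2(A,M)\cong\mathcal{E}xt(A,M)$, where $\mathcal{E}xt(A,M)$ denotes the set of equivalence classes of abelian extensions of $A$ by $M$ for which the induced representation on $M$ is the given one.
   Context: All vector spaces, tensor products and linear maps are over a field $\mathbb{K}$ of characteristic $0$. A non-symmetric operad is a collection $\{\mathcal{O}(n)\}_{n\ge1}$ of vector spaces with partial compositions $\circ_i:\mathcal{O}(m)\otimes\mathcal{O}(n)\to\mathcal{O}(m+n-1)$, $1\le i\le m$, satisfying the usual sequential and parallel associativity axioms, and an identity $\mathrm{id}\in\mathcal{O}(1)$. A multiplication on it is $\pi\in\mathcal{O}(2)$ with $\pi\circ_1\pi=\pi\circ_2\pi$. Loday type: fix a sequence of non-empty sets $\{U_n\}_{n\ge1}$ and structure functions, for $m,n\ge1$, $1\le i\le m$, $R^0_{m,i,n}:U_{m+n-1}\to U_m$ and $R^*_{m,i,n}:U_{m+n-1}\to\mathbb{K}[U_n]$ (denoted in the literature $R_0(m;1,\dots,n,\dots,1)$ and $R_i(m;1,\dots,n,\dots,1)$ with $n$ in the $i$-th place), such that for every vector space $V$ the spaces $\mathcal{O}_V(n)=\mathrm{Hom}_{\mathbb{K}}(\mathbb{K}[U_n]\otimes V^{\otimes n},V)$ form a non-symmetric operad with partial compositions $$(f\circ_i g)(r;a_1,\dots,a_{m+n-1})=f\big(R^0_{m,i,n}r;\ a_1,\dots,a_{i-1},\ g(R^*_{m,i,n}r;a_i,\dots,a_{i+n-1}),\ a_{i+n},\dots,a_{m+n-1}\big)$$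 for $f\in\mathcal{O}_V(m)$, $g\in\mathcal{O}_V(n)$, $r\in U_{m+n-1}$, and identity $\mathrm{id}(r;a)=a$ for all $r\in U_1$, $a\in V$. A Loday-type algebra (of this type) is a vector space $A$ with a multiplication $\pi=\pi_A$ on $\mathcal{O}_A$. A morphism $A\to B$ of Loday algebras of the same type is a linear map $f$ with $f(\pi_A(r;a,a'))=\pi_B(r;f(a),f(a'))$ for all $r\in U_2$, $a,a'\in A$. A representation of $A$ is a vector space $M$ with linear maps $\theta_1:\mathbb{K}[U_2]\otimes(A\otimes M)\to M$, $\theta_2:\mathbb{K}[U_2]\otimes(M\otimes A)\to M$ such that for all $y\in U_3$, $a,b\in A$, $m\in M$: $\theta_1(R^0_{2,2,2}y;a,\theta_1(R^*_{2,2,2}y;b,m))=\theta_1(R^0_{2,1,2}y;\pi(R^*_{2,1,2}y;a,b),m)$; $\theta_2(R^0_{2,2,2}y;m,\pi(R^*_{2,2,2}y;a,b))=\theta_2(R^0_{2,1,2}y;\theta_2(R^*_{2,1,2}y;m,a),b)$; $\theta_1(R^0_{2,2,2}y;a,\theta_2(R^*_{2,2,2}y;m,b))=\theta_2(R^0_{2,1,2}y;\theta_1(R^*_{2,1,2}y;a,m),b)$. Cohomology: $C^n(A,M)=\mathrm{Hom}_{\mathbb{K}}(\mathbb{K}[U_n]\otimes A^{\otimes n},M)$, $n\ge1$, with coboundary $\delta:C^n(A,M)\to C^{n+1}(A,M)$, $$(\delta f)(r;a_1,\dots,a_{n+1})=\theta_1\big(R^0_{2,2,n}r;a_1,f(R^*_{2,2,n}r;a_2,\dots,a_{n+1})\big)+\sum_{i=1}^n(-1)^if\big(R^0_{n,i,2}r;a_1,\dots,a_{i-1},\pi(R^*_{n,i,2}r;a_i,a_{i+1}),a_{i+2},\dots,a_{n+1}\big)+(-1)^{n+1}\theta_2\big(R^0_{2,1,n}r;f(R^*_{2,1,n}r;a_1,\dots,a_n),a_{n+1}\big)$$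 for $r\in U_{n+1}$ and $a_1,\dots,a_{n+1}\in A$. $H^n(A,M)$ is the $n$-th cohomology group of this complex; in particular $H^2(A,M)=\ker(\delta|_{C^2(A,M)})/\delta(C^1(A,M))$. Abelian extensions: regard the vector space $M$ as a Loday algebra of the same type with zero multiplication. An abelian extension of $A$ by $M$ is a short exact sequence $0\to M\xrightarrow{i}E\xrightarrow{j}A\to0$ of Loday algebras of the same type (with $i,j$ morphisms) that is split over $\mathbb{K}$. It induces a representation of $A$ on $M$ via $\theta_1(r;a,m)=\pi_E(r;s(a),i(m))$, $\theta_2(r;m,a)=\pi_E(r;i(m),s(a))$ (elements of $i(M)\cong M$), for any linear section $s$ of $j$; this is independent of $s$. Two abelian extensions $(E,i,j)$ and $(E',i',j')$ are equivalent if there is a morphism $\phi:E\to E'$ of Loday-type algebras with $\phi\circ i=i'$ and $j'\circ\phi=j$.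
   Formalization: The formal theorem assumes that U_1 has exactly one element. With U_1 only non-empty the claim is false: for U_n={u,v}, R^0 r=R^* r=r, A=M=ℚ with the usual products, H^2(A,M)=0 but Ext(A,M) is infinite. *)

theory Defs
  imports "HOL-Algebra.Algebra" "HOL-Library.NList"
begin

text \<open>
  A vector space over a field \<open>K\<close> is a module \<open>V\<close> with \<open>module K V\<close> (the ring-multiplication fields
  of the module record are never used).  The carriers of all vector spaces lie in one
  arbitrary type \<open>'u\<close>, which plays the role of a universe.
\<close>

definition field_char0 :: "'k ring \<Rightarrow> bool" where
  "field_char0 K \<longleftrightarrow> field K \<and> (\<forall>n::nat. n > 0 \<longrightarrow> [n] \<cdot>\<^bsub>K\<^esub> \<one>\<^bsub>K\<^esub> \<noteq> \<zero>\<^bsub>K\<^esub>)"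

definition linear_map ::
  "'k ring \<Rightarrow> ('k, 'a) module \<Rightarrow> ('k, 'b) module \<Rightarrow> ('a \<Rightarrow> 'b) \<Rightarrow> bool" where
  "linear_map K V W f \<longleftrightarrow>
     f \<in> carrier V \<rightarrow> carrier W \<and>
     (\<forall>x\<in>carrier V. \<forall>y\<in>carrier V. f (x \<oplus>\<^bsub>V\<^esub> y) = f x \<oplus>\<^bsub>W\<^esub> f y) \<and>
     (\<forall>c\<in>carrier K. \<forall>x\<in>carrier V. f (c \<odot>\<^bsub>V\<^esub> x) = c \<odot>\<^bsub>W\<^esub> f x)"

definition bilinear_map ::
  "'k ring \<Rightarrow> ('k, 'a) module \<Rightarrow> ('k, 'b) module \<Rightarrow> ('k, 'c) module \<Rightarrow> ('a \<Rightarrow> 'b \<Rightarrow> 'c) \<Rightarrow> bool" where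
  "bilinear_map K V V' W f \<longleftrightarrow>
     (\<forall>x\<in>carrier V. linear_map K V' W (f x)) \<and>
     (\<forall>y\<in>carrier V'. linear_map K V W (\<lambda>x. f x y))"

text \<open>Multilinear maps from the \<open>n\<close>-th power of \<open>V\<close> to \<open>W\<close>; an \<open>n\<close>-tuple is a list of length \<open>n\<close>.\<close>

definition multilinear_maps ::
  "'k ring \<Rightarrow> nat \<Rightarrow> ('k, 'a) module \<Rightarrow> ('k, 'b) module \<Rightarrow> ('a list \<Rightarrow> 'b) set" where
  "multilinear_maps K n V W =
     {\<phi> \<in> nlists n (carrier V) \<rightarrow>\<^sub>E carrier W.
        \<forall>as\<in>nlists n (carrier V). \<forall>i<n. linear_map K V W (\<lambda>x. \<phi> (as[i := x]))}"

text \<open>The free vector space \<open>K[S]\<close>, and the linear extension to \<open>K[S]\<close> of a map \<open>\<phi>\<close> from \<open>S\<close> to \<open>W\<close>.\<close>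

definition free_vectors :: "'k ring \<Rightarrow> 'r set \<Rightarrow> ('r \<Rightarrow> 'k) set" where
  "free_vectors K S =
     {x. (\<forall>s. x s \<in> carrier K) \<and> finite {s. x s \<noteq> \<zero>\<^bsub>K\<^esub>} \<and> {s. x s \<noteq> \<zero>\<^bsub>K\<^esub>} \<subseteq> S}"

definition lin_ext :: "'k ring \<Rightarrow> ('k, 'b) module \<Rightarrow> ('r \<Rightarrow> 'b) \<Rightarrow> ('r \<Rightarrow> 'k) \<Rightarrow> 'b" where
  "lin_ext K W \<phi> x = finsum W (\<lambda>s. x s \<odot>\<^bsub>W\<^esub> \<phi> s) {s. x s \<noteq> \<zero>\<^bsub>K\<^esub>}"

text \<open>
  Non-symmetric operads.  \<open>Op n\<close> is the space of \<open>n\<close>-ary operations, for \<open>n \<ge> 1\<close>;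
  \<open>pc m i n f g\<close> is the partial composition of \<open>f \<in> Op m\<close> and \<open>g \<in> Op n\<close> at the place \<open>i\<close>.
\<close>

definition ns_operad ::
  "'k ring \<Rightarrow> (nat \<Rightarrow> ('k, 'x) module) \<Rightarrow> (nat \<Rightarrow> nat \<Rightarrow> nat \<Rightarrow> 'x \<Rightarrow> 'x \<Rightarrow> 'x) \<Rightarrow> 'x \<Rightarrow> bool" where
  "ns_operad K Op pc ident \<longleftrightarrow>
     (\<forall>n\<ge>1. module K (Op n)) \<and>
     (\<forall>m n i. 1 \<le> i \<and> i \<le> m \<and> 1 \<le> n \<longrightarrow>
        bilinear_map K (Op m) (Op n) (Op (m + n - 1)) (pc m i n)) \<and>
     (\<forall>m n p i j. 1 \<le> i \<and> i \<le> m \<and> 1 \<le> j \<and> j \<le> n \<and> 1 \<le> p \<longrightarrow>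
        (\<forall>f\<in>carrier (Op m). \<forall>g\<in>carrier (Op n). \<forall>h\<in>carrier (Op p).
           pc (m + n - 1) (i + j - 1) p (pc m i n f g) h
             = pc m i (n + p - 1) f (pc n j p g h))) \<and>
     (\<forall>m n p i k. 1 \<le> i \<and> i < k \<and> k \<le> m \<and> 1 \<le> n \<and> 1 \<le> p \<longrightarrow>
        (\<forall>f\<in>carrier (Op m). \<forall>g\<in>carrier (Op n). \<forall>h\<in>carrier (Op p).
           pc (m + n - 1) (k + n - 1) p (pc m i n f g) h
             = pc (m + p - 1) i n (pc m k p f h) g)) \<and>
     ident \<in> carrier (Op 1) \<and>
     (\<forall>n\<ge>1. \<forall>g\<in>carrier (Op n). pc 1 1 n ident g = g) \<and>
     (\<forall>m i. 1 \<le> i \<and> i \<le> m \<longrightarrow> (\<forall>f\<in>carrier (Op m). pc m i 1 f ident = f))"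

definition operad_multiplication ::
  "(nat \<Rightarrow> ('k, 'x) module) \<Rightarrow> (nat \<Rightarrow> nat \<Rightarrow> nat \<Rightarrow> 'x \<Rightarrow> 'x \<Rightarrow> 'x) \<Rightarrow> 'x \<Rightarrow> bool" where
  "operad_multiplication Op pc mul \<longleftrightarrow>
     mul \<in> carrier (Op 2) \<and> pc 2 1 2 mul mul = pc 2 2 2 mul mul"

text \<open>
  The data of a Loday type: \<open>U n\<close> are the index sets, \<open>R0 m i n\<close> and \<open>Rs m i n\<close> the structure
  functions from \<open>U (m + n - 1)\<close> to \<open>U m\<close> and to \<open>K[U n]\<close>.
\<close>

record ('r, 'k) type_data =
  U :: "nat \<Rightarrow> 'r set"
  R0 :: "nat \<Rightarrow> nat \<Rightarrow> nat \<Rightarrow> 'r \<Rightarrow> 'r"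
  Rs :: "nat \<Rightarrow> nat \<Rightarrow> nat \<Rightarrow> 'r \<Rightarrow> 'r \<Rightarrow> 'k"

text \<open>
  \<open>hom_space K T n V W\<close> is the space of linear maps from the tensor product of \<open>K[U n]\<close> with the
  \<open>n\<close>-th tensor power of \<open>V\<close> to \<open>W\<close>.  By the universal properties of the free vector space and of
  the tensor product such a map is a family, indexed by \<open>U n\<close>, of multilinear maps; its value at
  an element of \<open>K[U n]\<close> is given by \<open>lin_ext\<close>.
\<close>

definition hom_space ::
  "'k ring \<Rightarrow> ('r, 'k) type_data \<Rightarrow> nat \<Rightarrow> ('k, 'a) module \<Rightarrow> ('k, 'b) module
     \<Rightarrow> ('k, 'r \<Rightarrow> 'a list \<Rightarrow> 'b) module" where
  "hom_space K T n V W =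
     \<lparr> carrier = U T n \<rightarrow>\<^sub>E multilinear_maps K n V W,
       monoid.mult = undefined,
       monoid.one = undefined,
       ring.zero = (\<lambda>r\<in>U T n. \<lambda>as\<in>nlists n (carrier V). \<zero>\<^bsub>W\<^esub>),
       ring.add = (\<lambda>f g. \<lambda>r\<in>U T n. \<lambda>as\<in>nlists n (carrier V). f r as \<oplus>\<^bsub>W\<^esub> g r as),
       smult = (\<lambda>c f. \<lambda>r\<in>U T n. \<lambda>as\<in>nlists n (carrier V). c \<odot>\<^bsub>W\<^esub> f r as) \<rparr>"

text \<open>
  Partial composition of \<open>f \<in> hom_space K T m V W\<close> with \<open>g \<in> hom_space K T n V V\<close>
  (with \<open>W = V\<close> in the operad; the coboundary uses it for a general \<open>W\<close>).
\<close>

definition pcomp ::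
  "'k ring \<Rightarrow> ('r, 'k) type_data \<Rightarrow> ('k, 'a) module \<Rightarrow> nat \<Rightarrow> nat \<Rightarrow> nat
     \<Rightarrow> ('r \<Rightarrow> 'a list \<Rightarrow> 'b) \<Rightarrow> ('r \<Rightarrow> 'a list \<Rightarrow> 'a) \<Rightarrow> ('r \<Rightarrow> 'a list \<Rightarrow> 'b)" where
  "pcomp K T V m i n f g =
     (\<lambda>r\<in>U T (m + n - 1). \<lambda>as\<in>nlists (m + n - 1) (carrier V).
        f (R0 T m i n r)
          (take (i - 1) as
           @ [lin_ext K V (\<lambda>s. g s (take n (drop (i - 1) as))) (Rs T m i n r)]
           @ drop (i - 1 + n) as))"

definition pident :: "('r, 'k) type_data \<Rightarrow> ('k, 'a) module \<Rightarrow> ('r \<Rightarrow> 'a list \<Rightarrow> 'a)" where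
  "pident T V = (\<lambda>r\<in>U T 1. \<lambda>as\<in>nlists 1 (carrier V). as ! 0)"

definition loday_type :: "'u itself \<Rightarrow> 'k ring \<Rightarrow> ('r, 'k) type_data \<Rightarrow> bool" where
  "loday_type _ K T \<longleftrightarrow>
     (\<forall>n\<ge>1. U T n \<noteq> {}) \<and>
     (\<forall>m n i. 1 \<le> i \<and> i \<le> m \<and> 1 \<le> n \<longrightarrow>
        R0 T m i n \<in> U T (m + n - 1) \<rightarrow> U T m \<and>
        Rs T m i n \<in> U T (m + n - 1) \<rightarrow> free_vectors K (U T n)) \<and>
     (\<forall>V :: ('k, 'u) module. module K V \<longrightarrow>
        ns_operad K (\<lambda>n. hom_space K T n V V) (pcomp K T V) (pident T V))"

definition loday_algebra ::
  "'k ring \<Rightarrow> ('r, 'k) type_data \<Rightarrow> ('k, 'u) module \<Rightarrow> ('r \<Rightarrow> 'u list \<Rightarrow> 'u) \<Rightarrow> bool" where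
  "loday_algebra K T A mul \<longleftrightarrow>
     module K A \<and> operad_multiplication (\<lambda>n. hom_space K T n A A) (pcomp K T A) mul"

definition loday_morphism ::
  "'k ring \<Rightarrow> ('r, 'k) type_data \<Rightarrow> ('k, 'u) module \<Rightarrow> ('r \<Rightarrow> 'u list \<Rightarrow> 'u)
     \<Rightarrow> ('k, 'u) module \<Rightarrow> ('r \<Rightarrow> 'u list \<Rightarrow> 'u) \<Rightarrow> ('u \<Rightarrow> 'u) \<Rightarrow> bool" where
  "loday_morphism K T A mulA B mulB f \<longleftrightarrow>
     linear_map K A B f \<and>
     (\<forall>r\<in>U T 2. \<forall>a\<in>carrier A. \<forall>a'\<in>carrier A. f (mulA r [a, a']) = mulB r [f a, f a'])"

definition loday_representation ::
  "'k ring \<Rightarrow> ('r, 'k) type_data \<Rightarrow> ('k, 'u) module \<Rightarrow> ('r \<Rightarrow> 'u list \<Rightarrow> 'u) \<Rightarrow> ('k, 'u) module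
     \<Rightarrow> ('r \<Rightarrow> 'u \<Rightarrow> 'u \<Rightarrow> 'u) \<Rightarrow> ('r \<Rightarrow> 'u \<Rightarrow> 'u \<Rightarrow> 'u) \<Rightarrow> bool" where
  "loday_representation K T A mul M \<theta>1 \<theta>2 \<longleftrightarrow>
     module K M \<and>
     (\<forall>r\<in>U T 2. bilinear_map K A M M (\<theta>1 r)) \<and>
     (\<forall>r\<in>U T 2. bilinear_map K M A M (\<theta>2 r)) \<and>
     (\<forall>y\<in>U T 3. \<forall>a\<in>carrier A. \<forall>b\<in>carrier A. \<forall>m\<in>carrier M.
        \<theta>1 (R0 T 2 2 2 y) a (lin_ext K M (\<lambda>s. \<theta>1 s b m) (Rs T 2 2 2 y))
          = \<theta>1 (R0 T 2 1 2 y) (lin_ext K A (\<lambda>s. mul s [a, b]) (Rs T 2 1 2 y)) m \<and>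
        \<theta>2 (R0 T 2 2 2 y) m (lin_ext K A (\<lambda>s. mul s [a, b]) (Rs T 2 2 2 y))
          = \<theta>2 (R0 T 2 1 2 y) (lin_ext K M (\<lambda>s. \<theta>2 s m a) (Rs T 2 1 2 y)) b \<and>
        \<theta>1 (R0 T 2 2 2 y) a (lin_ext K M (\<lambda>s. \<theta>2 s m b) (Rs T 2 2 2 y))
          = \<theta>2 (R0 T 2 1 2 y) (lin_ext K M (\<lambda>s. \<theta>1 s a m) (Rs T 2 1 2 y)) b)"

text \<open>
  The cochain complex: the \<open>n\<close>-cochains are the elements of \<open>hom_space K T n A M\<close>, \<open>n \<ge> 1\<close>.
  A 1-cochain is a family of linear maps indexed by \<open>U 1\<close>, whereas an equivalence of extensions
  gives a single linear map from \<open>A\<close> to \<open>M\<close>.  The two agree when \<open>U 1\<close> is a singleton; without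
  this, second cohomology need not classify extensions.
\<close>

definition coboundary ::
  "'k ring \<Rightarrow> ('r, 'k) type_data \<Rightarrow> ('k, 'u) module \<Rightarrow> ('r \<Rightarrow> 'u list \<Rightarrow> 'u) \<Rightarrow> ('k, 'u) module
     \<Rightarrow> ('r \<Rightarrow> 'u \<Rightarrow> 'u \<Rightarrow> 'u) \<Rightarrow> ('r \<Rightarrow> 'u \<Rightarrow> 'u \<Rightarrow> 'u)
     \<Rightarrow> nat \<Rightarrow> ('r \<Rightarrow> 'u list \<Rightarrow> 'u) \<Rightarrow> ('r \<Rightarrow> 'u list \<Rightarrow> 'u)" where
  "coboundary K T A mul M \<theta>1 \<theta>2 n f =
     (\<lambda>r\<in>U T (n + 1). \<lambda>as\<in>nlists (n + 1) (carrier A).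
        \<theta>1 (R0 T 2 2 n r) (hd as) (lin_ext K M (\<lambda>s. f s (tl as)) (Rs T 2 2 n r))
        \<oplus>\<^bsub>M\<^esub> (\<Oplus>\<^bsub>M\<^esub>i\<in>{1..n}. ((\<ominus>\<^bsub>K\<^esub> \<one>\<^bsub>K\<^esub>) [^]\<^bsub>K\<^esub> i) \<odot>\<^bsub>M\<^esub> pcomp K T A n i 2 f mul r as)
        \<oplus>\<^bsub>M\<^esub> ((\<ominus>\<^bsub>K\<^esub> \<one>\<^bsub>K\<^esub>) [^]\<^bsub>K\<^esub> (n + 1)) \<odot>\<^bsub>M\<^esub>
             \<theta>2 (R0 T 2 1 n r) (lin_ext K M (\<lambda>s. f s (butlast as)) (Rs T 2 1 n r)) (last as))"

definition cohomology ::
  "'k ring \<Rightarrow> ('r, 'k) type_data \<Rightarrow> ('k, 'u) module \<Rightarrow> ('r \<Rightarrow> 'u list \<Rightarrow> 'u) \<Rightarrow> ('k, 'u) module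
     \<Rightarrow> ('r \<Rightarrow> 'u \<Rightarrow> 'u \<Rightarrow> 'u) \<Rightarrow> ('r \<Rightarrow> 'u \<Rightarrow> 'u \<Rightarrow> 'u)
     \<Rightarrow> nat \<Rightarrow> ('r \<Rightarrow> 'u list \<Rightarrow> 'u) set monoid" where
  "cohomology K T A mul M \<theta>1 \<theta>2 n =
     (let C = (\<lambda>k. hom_space K T k A M);
          \<delta> = coboundary K T A mul M \<theta>1 \<theta>2;
          Z = a_kernel (C n) (C (n + 1)) (\<delta> n);
          B = (if n = 1 then {\<zero>\<^bsub>C 1\<^esub>} else \<delta> (n - 1) ` carrier (C (n - 1)))
      in (C n)\<lparr>carrier := Z\<rparr> A_Mod B)"

record ('k, 'r, 'u) extension =
  ext_space :: "('k, 'u) module"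
  ext_mult :: "'r \<Rightarrow> 'u list \<Rightarrow> 'u"
  ext_incl :: "'u \<Rightarrow> 'u"
  ext_proj :: "'u \<Rightarrow> 'u"

definition linear_section ::
  "'k ring \<Rightarrow> ('k, 'u) module \<Rightarrow> ('k, 'u) module \<Rightarrow> ('u \<Rightarrow> 'u) \<Rightarrow> ('u \<Rightarrow> 'u) \<Rightarrow> bool" where
  "linear_section K E A j s \<longleftrightarrow> linear_map K A E s \<and> (\<forall>a\<in>carrier A. j (s a) = a)"

text \<open>\<open>M\<close> is a Loday algebra with the zero multiplication \<open>ring.zero (hom_space K T 2 M M)\<close>.\<close>

definition abelian_extension ::
  "'k ring \<Rightarrow> ('r, 'k) type_data \<Rightarrow> ('k, 'u) module \<Rightarrow> ('r \<Rightarrow> 'u list \<Rightarrow> 'u) \<Rightarrow> ('k, 'u) module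
     \<Rightarrow> ('k, 'r, 'u) extension \<Rightarrow> bool" where
  "abelian_extension K T A mul M P \<longleftrightarrow>
     loday_algebra K T (ext_space P) (ext_mult P) \<and>
     loday_morphism K T M \<zero>\<^bsub>hom_space K T 2 M M\<^esub> (ext_space P) (ext_mult P) (ext_incl P) \<and>
     loday_morphism K T (ext_space P) (ext_mult P) A mul (ext_proj P) \<and>
     inj_on (ext_incl P) (carrier M) \<and>
     ext_incl P ` carrier M = a_kernel (ext_space P) A (ext_proj P) \<and>
     ext_proj P ` carrier (ext_space P) = carrier A \<and>
     (\<exists>s. linear_section K (ext_space P) A (ext_proj P) s)"

definition induces_representation ::
  "'k ring \<Rightarrow> ('r, 'k) type_data \<Rightarrow> ('k, 'u) module \<Rightarrow> ('k, 'u) module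
     \<Rightarrow> ('r \<Rightarrow> 'u \<Rightarrow> 'u \<Rightarrow> 'u) \<Rightarrow> ('r \<Rightarrow> 'u \<Rightarrow> 'u \<Rightarrow> 'u) \<Rightarrow> ('k, 'r, 'u) extension \<Rightarrow> bool" where
  "induces_representation K T A M \<theta>1 \<theta>2 P \<longleftrightarrow>
     (\<forall>s. linear_section K (ext_space P) A (ext_proj P) s \<longrightarrow>
        (\<forall>r\<in>U T 2. \<forall>a\<in>carrier A. \<forall>m\<in>carrier M.
           ext_incl P (\<theta>1 r a m) = ext_mult P r [s a, ext_incl P m] \<and>
           ext_incl P (\<theta>2 r m a) = ext_mult P r [ext_incl P m, s a]))"

definition equivalent_extensions ::
  "'k ring \<Rightarrow> ('r, 'k) type_data \<Rightarrow> ('k, 'u) module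
     \<Rightarrow> ('k, 'r, 'u) extension \<Rightarrow> ('k, 'r, 'u) extension \<Rightarrow> bool" where
  "equivalent_extensions K T M P Q \<longleftrightarrow>
     (\<exists>\<phi>. loday_morphism K T (ext_space P) (ext_mult P) (ext_space Q) (ext_mult Q) \<phi> \<and>
          (\<forall>m\<in>carrier M. \<phi> (ext_incl P m) = ext_incl Q m) \<and>
          (\<forall>e\<in>carrier (ext_space P). ext_proj Q (\<phi> e) = ext_proj P e))"

text \<open>
  The set of equivalence classes.  No cardinality condition on \<open>'u\<close> is needed for it to contain
  all extensions up to equivalence: \<open>K\<close> is infinite, so unless both \<open>A\<close> and \<open>M\<close> are zero, \<open>'u\<close> is
  infinite and every extension, having as many elements as \<open>A \<times> M\<close>, is equivalent to one
  with carrier in \<open>'u\<close>.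
\<close>

definition Ext ::
  "'k ring \<Rightarrow> ('r, 'k) type_data \<Rightarrow> ('k, 'u) module \<Rightarrow> ('r \<Rightarrow> 'u list \<Rightarrow> 'u) \<Rightarrow> ('k, 'u) module
     \<Rightarrow> ('r \<Rightarrow> 'u \<Rightarrow> 'u \<Rightarrow> 'u) \<Rightarrow> ('r \<Rightarrow> 'u \<Rightarrow> 'u \<Rightarrow> 'u) \<Rightarrow> ('k, 'r, 'u) extension set set" where
  "Ext K T A mul M \<theta>1 \<theta>2 =
     (let S = {P. abelian_extension K T A mul M P \<and> induces_representation K T A M \<theta>1 \<theta>2 P}
      in S // {(P, Q). P \<in> S \<and> Q \<in> S \<and> equivalent_extensions K T M P Q})"

end

theory Submission
  imports Defs
begin

text \<open>
  A 2-cochain \<open>z\<close> twists the multiplication of the semidirect product on \<open>A \<times> M\<close>; the result is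
  associative exactly when \<open>z\<close> is a cocycle.  A linear section of an extension identifies it
  with such a twisted product, and an equivalence between the twisted products of \<open>z\<close> and \<open>z'\<close> is
  a shear along a linear map \<open>h\<close> from \<open>A\<close> to \<open>M\<close>, i.e. a 1-cochain, with \<open>z - z' = \<delta> h\<close>.  Two points
  need care: the structure functions at arity 1 enter \<open>\<delta> h\<close>, and are removed by the unit axioms of
  the operads on \<open>A\<close> and on \<open>A \<times> M\<close>; and \<open>A \<times> M\<close> has to be encoded in the universe \<open>'u\<close>, which
  is possible because a nonzero vector space in characteristic 0 is infinite.
\<close>

section \<open>Linear maps\<close>

text \<open>The obstacle at arity 1 is that the unit axioms concern operations on one space, while
  \<open>\<theta>1\<close> and \<open>\<theta>2\<close> take arguments from two. The semidirect
  product packs both actions into a single binary operation on the sum of \<open>A\<close> and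
  \<open>M\<close>, to which the axioms apply; on arguments with one zero component each they become
  unit laws for the actions. Since \<open>U T 1\<close> has one element, a vector of
  \<open>K[U 1]\<close> amounts to a scalar, and these laws absorb that scalar together with the
  change of index by \<open>R0\<close>.

  The hinge is \<open>cohomologous_via\<close>: moving the negative terms of
  \<open>z - z' = \<delta> h\<close> to the other side gives the \<open>M\<close> component of the
  multiplicativity of the shear. Both classifications are therefore quotients of one set of cocycles
  by one relation. For the cochain of a given extension the cocycle identity is not computed but
  read off from associativity, pulled back along the comparison map of a section.\<close>

lemma linear_mapI:
  assumes "\<And>x. x \<in> carrier V \<Longrightarrow> f x \<in> carrier W"
    and "\<And>x y. \<lbrakk>x \<in> carrier V; y \<in> carrier V\<rbrakk> \<Longrightarrow> f (x \<oplus>\<^bsub>V\<^esub> y) = f x \<oplus>\<^bsub>W\<^esub> f y"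
    and "\<And>c x. \<lbrakk>c \<in> carrier K; x \<in> carrier V\<rbrakk> \<Longrightarrow> f (c \<odot>\<^bsub>V\<^esub> x) = c \<odot>\<^bsub>W\<^esub> f x"
  shows "linear_map K V W f"
  using assms by (auto simp: linear_map_def)

lemma linear_map_closed: "linear_map K V W f \<Longrightarrow> x \<in> carrier V \<Longrightarrow> f x \<in> carrier W"
  by (auto simp: linear_map_def)

lemma linear_map_add:
  "linear_map K V W f \<Longrightarrow> x \<in> carrier V \<Longrightarrow> y \<in> carrier V \<Longrightarrow> f (x \<oplus>\<^bsub>V\<^esub> y) = f x \<oplus>\<^bsub>W\<^esub> f y"
  by (auto simp: linear_map_def)

lemma linear_map_smult:
  "linear_map K V W f \<Longrightarrow> c \<in> carrier K \<Longrightarrow> x \<in> carrier V \<Longrightarrow> f (c \<odot>\<^bsub>V\<^esub> x) = c \<odot>\<^bsub>W\<^esub> f x"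
  by (auto simp: linear_map_def)

lemma linear_map_cong:
  assumes "module K V" "linear_map K V W f" "\<And>x. x \<in> carrier V \<Longrightarrow> f x = g x"
  shows "linear_map K V W g"
proof -
  interpret V: module K V by fact
  show ?thesis
    using assms(2) by (auto simp: linear_map_def assms(3)[symmetric])
qed

text \<open>Gives access to the library facts on additive homomorphisms, from which preservation of
  zero, negatives and finite sums follows.\<close>

lemma abelian_group_hom_linear_map:
  assumes "module K V" "module K W" "linear_map K V W f"
  shows "abelian_group_hom V W f"
proof -
  interpret V: module K V by fact
  interpret W: module K W by fact
  show ?thesis
    using assms(3) V.abelian_group_axioms W.abelian_group_axioms V.a_group W.a_group
    by (intro abelian_group_homI)
       (auto simp: group_hom_def group_hom_axioms_def hom_def linear_map_def)
qed

lemma linear_map_zero: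
  assumes "module K V" "module K W" "linear_map K V W f"
  shows "f \<zero>\<^bsub>V\<^esub> = \<zero>\<^bsub>W\<^esub>"
  using abelian_group_hom.hom_zero[OF abelian_group_hom_linear_map[OF assms]] .

lemma linear_map_minus:
  assumes "module K V" "module K W" "linear_map K V W f" "x \<in> carrier V"
  shows "f (\<ominus>\<^bsub>V\<^esub> x) = \<ominus>\<^bsub>W\<^esub> f x"
  using abelian_group_hom.hom_a_inv[OF abelian_group_hom_linear_map[OF assms(1-3)]] assms(4) .

lemma linear_map_finsum:
  assumes "module K V" "module K W" "linear_map K V W f" "finite I" "g \<in> I \<rightarrow> carrier V"
  shows "f (finsum V g I) = finsum W (\<lambda>i. f (g i)) I"
proof -
  interpret abelian_group_hom V W f
    by (rule abelian_group_hom_linear_map) fact+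
  interpret W: module K W by fact
  show ?thesis
    using assms(4,5)
  proof (induction rule: finite_induct)
    case (insert i I)
    then show ?case
      by (simp add: Pi_iff)
  qed simp
qed

lemma linear_map_id: "linear_map K V V (\<lambda>x. x)"
  by (simp add: linear_map_def)

lemma linear_map_comp:
  assumes "linear_map K V W f" "linear_map K W Z g"
  shows "linear_map K V Z (\<lambda>x. g (f x))"
  using assms by (auto simp: linear_map_def Pi_iff)

lemma linear_map_zero_map:
  assumes "module K W"
  shows "linear_map K V W (\<lambda>x. \<zero>\<^bsub>W\<^esub>)"
proof -
  interpret W: module K W by fact
  show ?thesis by (rule linear_mapI) auto
qed

lemma linear_map_sum:
  assumes "module K W" "linear_map K V W f" "linear_map K V W g"
  shows "linear_map K V W (\<lambda>x. f x \<oplus>\<^bsub>W\<^esub> g x)"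
proof -
  interpret W: module K W by fact
  show ?thesis
    using assms(2,3)
    by (intro linear_mapI)
       (auto simp: linear_map_closed linear_map_add linear_map_smult W.a_ac W.smult_r_distr)
qed

lemma linear_map_uminus:
  assumes "module K W" "linear_map K V W f"
  shows "linear_map K V W (\<lambda>x. \<ominus>\<^bsub>W\<^esub> f x)"
proof -
  interpret W: module K W by fact
  show ?thesis
    using assms(2)
    by (intro linear_mapI)
       (auto simp: linear_map_closed linear_map_add linear_map_smult W.minus_add W.smult_r_minus W.a_comm)
qed

lemma linear_map_inv_into:
  assumes "module K V" "linear_map K V W f" "bij_betw f (carrier V) (carrier W)"
  shows "linear_map K W V (inv_into (carrier V) f)"
proof -
  interpret V: module K V by fact
  let ?g = "inv_into (carrier V) f"
  have g: "?g y \<in> carrier V" "f (?g y) = y" if "y \<in> carrier W" for y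
    using that assms(3) by (auto simp: bij_betw_def inv_into_into f_inv_into_f)
  have inj: "inj_on f (carrier V)"
    using assms(3) by (simp add: bij_betw_def)
  show ?thesis
  proof (rule linear_mapI)
    fix x y assume xy: "x \<in> carrier W" "y \<in> carrier W"
    have "?g (f (?g x \<oplus>\<^bsub>V\<^esub> ?g y)) = ?g x \<oplus>\<^bsub>V\<^esub> ?g y"
      using xy g by (intro inv_into_f_f[OF inj]) auto
    then show "?g (x \<oplus>\<^bsub>W\<^esub> y) = ?g x \<oplus>\<^bsub>V\<^esub> ?g y"
      using xy g by (simp add: linear_map_add[OF assms(2)])
  next
    fix c x assume cx: "c \<in> carrier K" "x \<in> carrier W"
    have "?g (f (c \<odot>\<^bsub>V\<^esub> ?g x)) = c \<odot>\<^bsub>V\<^esub> ?g x"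
      using cx g by (intro inv_into_f_f[OF inj]) auto
    then show "?g (c \<odot>\<^bsub>W\<^esub> x) = c \<odot>\<^bsub>V\<^esub> ?g x"
      using cx g by (simp add: linear_map_smult[OF assms(2)])
  qed (use g in auto)
qed

lemma bilinear_mapI:
  assumes "\<And>x. x \<in> carrier V \<Longrightarrow> linear_map K V' W (f x)"
    and "\<And>y. y \<in> carrier V' \<Longrightarrow> linear_map K V W (\<lambda>x. f x y)"
  shows "bilinear_map K V V' W f"
  using assms by (simp add: bilinear_map_def)

lemma bilinear_map_left: "bilinear_map K V V' W f \<Longrightarrow> y \<in> carrier V' \<Longrightarrow> linear_map K V W (\<lambda>x. f x y)"
  by (simp add: bilinear_map_def)

lemma bilinear_map_right: "bilinear_map K V V' W f \<Longrightarrow> x \<in> carrier V \<Longrightarrow> linear_map K V' W (f x)"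
  by (simp add: bilinear_map_def)

lemma bilinear_map_closed:
  "bilinear_map K V V' W f \<Longrightarrow> x \<in> carrier V \<Longrightarrow> y \<in> carrier V' \<Longrightarrow> f x y \<in> carrier W"
  by (meson bilinear_map_right linear_map_closed)

lemma bilinear_map_sum:
  assumes "module K W" "bilinear_map K V V' W f" "bilinear_map K V V' W g"
  shows "bilinear_map K V V' W (\<lambda>x y. f x y \<oplus>\<^bsub>W\<^esub> g x y)"
  using assms by (auto simp: bilinear_map_def intro: linear_map_sum)

lemma bilinear_map_uminus:
  assumes "module K W" "bilinear_map K V V' W f"
  shows "bilinear_map K V V' W (\<lambda>x y. \<ominus>\<^bsub>W\<^esub> f x y)"
  using assms by (auto simp: bilinear_map_def intro: linear_map_uminus)

text \<open>The common pattern of the bilinear maps built below from products, actions and cochains: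
  linear maps are inserted in the two arguments and applied to the result, with the identity where
  nothing happens.\<close>

lemma bilinear_map_compose:
  assumes "bilinear_map K V V' W f" "linear_map K Z V g" "linear_map K Z' V' g'" "linear_map K W W' h"
  shows "bilinear_map K Z Z' W' (\<lambda>x y. h (f (g x) (g' y)))"
proof (rule bilinear_mapI)
  fix x assume x: "x \<in> carrier Z"
  have L: "linear_map K V' W (f (g x))"
    using assms x by (auto intro: bilinear_map_right linear_map_closed)
  show "linear_map K Z' W' (\<lambda>y. h (f (g x) (g' y)))"
    by (rule linear_map_comp[OF linear_map_comp[OF assms(3) L] assms(4)])
next
  fix y assume y: "y \<in> carrier Z'"
  have L: "linear_map K V W (\<lambda>v. f v (g' y))"
    using assms y by (auto intro: bilinear_map_left linear_map_closed)
  show "linear_map K Z W' (\<lambda>x. h (f (g x) (g' y)))"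
    by (rule linear_map_comp[OF linear_map_comp[OF assms(2) L] assms(4)])
qed

section \<open>Linear extension from a free vector space\<close>

lemma lin_ext_in_carrier:
  assumes "module K V" "x \<in> free_vectors K S" "\<phi> \<in> S \<rightarrow> carrier V"
  shows "lin_ext K V \<phi> x \<in> carrier V"
proof -
  interpret V: module K V by fact
  show ?thesis
    using assms(2,3) unfolding lin_ext_def free_vectors_def
    by (intro V.finsum_closed) auto
qed

lemma lin_ext_cong:
  assumes "module K V" "x \<in> free_vectors K S" "\<psi> \<in> S \<rightarrow> carrier V" "\<And>s. s \<in> S \<Longrightarrow> \<phi> s = \<psi> s"
  shows "lin_ext K V \<phi> x = lin_ext K V \<psi> x"
proof -
  interpret V: module K V by fact
  show ?thesis
    using assms(2-4) unfolding lin_ext_def free_vectors_def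
    by (intro V.finsum_cong') (auto simp: Pi_iff subset_iff)
qed

text \<open>A linear extension is a finite linear combination. This is applied to the projections of
  a direct sum and to the map comparing a twisted product with an extension.\<close>

lemma linear_map_lin_ext:
  assumes "module K V" "module K W" "linear_map K V W f" "x \<in> free_vectors K S" "\<phi> \<in> S \<rightarrow> carrier V"
  shows "f (lin_ext K V \<phi> x) = lin_ext K W (\<lambda>s. f (\<phi> s)) x"
proof -
  interpret V: module K V by fact
  interpret W: module K W by fact
  have fin: "finite {s. x s \<noteq> \<zero>\<^bsub>K\<^esub>}" and sub: "{s. x s \<noteq> \<zero>\<^bsub>K\<^esub>} \<subseteq> S" and x: "\<And>s. x s \<in> carrier K"
    using assms(4) by (auto simp: free_vectors_def)
  have "f (lin_ext K V \<phi> x) = finsum W (\<lambda>s. f (x s \<odot>\<^bsub>V\<^esub> \<phi> s)) {s. x s \<noteq> \<zero>\<^bsub>K\<^esub>}"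
    unfolding lin_ext_def using sub x assms(5)
    by (intro linear_map_finsum[OF assms(1-3) fin]) auto
  also have "\<dots> = lin_ext K W (\<lambda>s. f (\<phi> s)) x"
    unfolding lin_ext_def using sub x assms(5)
    by (intro W.finsum_cong')
       (auto simp: linear_map_smult[OF assms(3)] Pi_iff intro!: W.smult_closed linear_map_closed[OF assms(3)])
  finally show ?thesis .
qed

lemma lin_ext_add:
  assumes "module K V" "x \<in> free_vectors K S" "\<phi> \<in> S \<rightarrow> carrier V" "\<psi> \<in> S \<rightarrow> carrier V"
  shows "lin_ext K V (\<lambda>s. \<phi> s \<oplus>\<^bsub>V\<^esub> \<psi> s) x = lin_ext K V \<phi> x \<oplus>\<^bsub>V\<^esub> lin_ext K V \<psi> x"
proof -
  interpret V: module K V by fact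
  have fin: "finite {s. x s \<noteq> \<zero>\<^bsub>K\<^esub>}" and sub: "{s. x s \<noteq> \<zero>\<^bsub>K\<^esub>} \<subseteq> S" and x: "\<And>s. x s \<in> carrier K"
    using assms(2) by (auto simp: free_vectors_def)
  have "lin_ext K V (\<lambda>s. \<phi> s \<oplus>\<^bsub>V\<^esub> \<psi> s) x
      = finsum V (\<lambda>s. x s \<odot>\<^bsub>V\<^esub> \<phi> s \<oplus>\<^bsub>V\<^esub> x s \<odot>\<^bsub>V\<^esub> \<psi> s) {s. x s \<noteq> \<zero>\<^bsub>K\<^esub>}"
    unfolding lin_ext_def using sub x assms(3,4)
    by (intro V.finsum_cong') (auto simp: V.smult_r_distr Pi_iff subset_iff)
  also have "\<dots> = lin_ext K V \<phi> x \<oplus>\<^bsub>V\<^esub> lin_ext K V \<psi> x"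
    unfolding lin_ext_def using sub x assms(3,4)
    by (intro V.finsum_addf) (auto simp: Pi_iff subset_iff)
  finally show ?thesis .
qed

section \<open>Cochains\<close>

lemma nlists_1_iff: "as \<in> nlists (Suc 0) S \<longleftrightarrow> (\<exists>a\<in>S. as = [a])"
  unfolding nlists_Suc by force

lemma nlists_2_iff: "as \<in> nlists 2 S \<longleftrightarrow> (\<exists>a\<in>S. \<exists>b\<in>S. as = [a, b])"
proof (cases as)
  case Nil
  have "[] \<notin> nlists 2 S"
    by (metis list.size(3) nlistsE_length zero_neq_numeral)
  then show ?thesis
    unfolding Nil by simp
next
  case (Cons a l)
  have "a # l \<in> nlists 2 S \<longleftrightarrow> a \<in> S \<and> l \<in> nlists (Suc 0) S"
    unfolding numeral_2_eq_2 Cons_in_nlists_Suc ..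
  then show ?thesis
    unfolding Cons nlists_1_iff by simp
qed

lemma nlists_3_iff: "as \<in> nlists 3 S \<longleftrightarrow> (\<exists>a\<in>S. \<exists>b\<in>S. \<exists>c\<in>S. as = [a, b, c])"
proof (cases as)
  case Nil
  have "[] \<notin> nlists 3 S"
    by (metis list.size(3) nlistsE_length zero_neq_numeral)
  then show ?thesis
    unfolding Nil by simp
next
  case (Cons a l)
  have "a # l \<in> nlists 3 S \<longleftrightarrow> a \<in> S \<and> l \<in> nlists 2 S"
    unfolding numeral_3_eq_3 numeral_2_eq_2 Cons_in_nlists_Suc ..
  then show ?thesis
    unfolding Cons nlists_2_iff by simp
qed

lemma ball_nlists_3: "(\<forall>as\<in>nlists 3 S. P as) \<longleftrightarrow> (\<forall>a\<in>S. \<forall>b\<in>S. \<forall>c\<in>S. P [a, b, c])"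
  by (auto simp: nlists_3_iff)

lemma nlists_list_update:
  "as \<in> nlists n S \<Longrightarrow> x \<in> S \<Longrightarrow> as[i := x] \<in> nlists n S"
  using set_update_subset_insert[of as i x] unfolding nlists_def by fastforce

text \<open>Two functions occur because \<open>\<phi>\<close> is cut off to \<open>undefined\<close>
  outside the lists of length \<open>n\<close>, whereas linearity is proved for the plain expression
  \<open>\<psi>\<close>. Updating an entry stays among these lists, so the two agree there.\<close>

lemma multilinear_mapsI:
  assumes V: "module K V" and "\<phi> \<in> nlists n (carrier V) \<rightarrow>\<^sub>E carrier W"
    and "\<And>as i. as \<in> nlists n (carrier V) \<Longrightarrow> i < n \<Longrightarrow> linear_map K V W (\<lambda>x. \<psi> (as[i := x]))"
    and "\<And>as. as \<in> nlists n (carrier V) \<Longrightarrow> \<phi> as = \<psi> as"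
  shows "\<phi> \<in> multilinear_maps K n V W"
  unfolding multilinear_maps_def using assms
  by (auto intro!: linear_map_cong[OF V assms(3)] nlists_list_update)

lemma hom_space_carrier_iff:
  "f \<in> carrier (hom_space K T n V W) \<longleftrightarrow>
     (\<forall>r\<in>U T n. f r \<in> multilinear_maps K n V W) \<and> (\<forall>r. r \<notin> U T n \<longrightarrow> f r = undefined)"
  by (auto simp: hom_space_def PiE_iff extensional_def)

lemma hom_space_eqI:
  assumes "f \<in> carrier (hom_space K T n V W)" "g \<in> carrier (hom_space K T n V W)"
    and "\<And>r as. r \<in> U T n \<Longrightarrow> as \<in> nlists n (carrier V) \<Longrightarrow> f r as = g r as"
  shows "f = g"
proof
  fix r
  show "f r = g r"
  proof (cases "r \<in> U T n")
    case True
    then have "f r \<in> nlists n (carrier V) \<rightarrow>\<^sub>E carrier W" "g r \<in> nlists n (carrier V) \<rightarrow>\<^sub>E carrier W"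
      using assms(1,2) by (auto simp: hom_space_carrier_iff multilinear_maps_def)
    then show ?thesis
      by (rule PiE_ext) (use assms(3) True in auto)
  next
    case False
    then show ?thesis
      using assms(1,2) by (simp add: hom_space_carrier_iff)
  qed
qed

lemma hom_space_closed:
  assumes "f \<in> carrier (hom_space K T n V W)" "r \<in> U T n" "as \<in> nlists n (carrier V)"
  shows "f r as \<in> carrier W"
  using assms by (auto simp: hom_space_carrier_iff multilinear_maps_def)

lemma hom_space_add_apply:
  "r \<in> U T n \<Longrightarrow> as \<in> nlists n (carrier V) \<Longrightarrow> (f \<oplus>\<^bsub>hom_space K T n V W\<^esub> g) r as = f r as \<oplus>\<^bsub>W\<^esub> g r as"
  by (simp add: hom_space_def)

lemma hom_space_zero_apply:
  "r \<in> U T n \<Longrightarrow> as \<in> nlists n (carrier V) \<Longrightarrow> \<zero>\<^bsub>hom_space K T n V W\<^esub> r as = \<zero>\<^bsub>W\<^esub>"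
  by (simp add: hom_space_def)

lemma hom_space_restrictI:
  assumes "module K V"
    and "\<And>r as. r \<in> U T n \<Longrightarrow> as \<in> nlists n (carrier V) \<Longrightarrow> F r as \<in> carrier W"
    and "\<And>r as i. r \<in> U T n \<Longrightarrow> as \<in> nlists n (carrier V) \<Longrightarrow> i < n
           \<Longrightarrow> linear_map K V W (\<lambda>x. F r (as[i := x]))"
  shows "(\<lambda>r\<in>U T n. \<lambda>as\<in>nlists n (carrier V). F r as) \<in> carrier (hom_space K T n V W)"
  unfolding hom_space_carrier_iff using assms
  by (auto intro!: multilinear_mapsI[where \<psi> = "F r" for r])

lemma hom_space_linear:
  assumes "f \<in> carrier (hom_space K T n V W)" "r \<in> U T n" "as \<in> nlists n (carrier V)" "i < n"
  shows "linear_map K V W (\<lambda>x. f r (as[i := x]))"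
  using assms by (auto simp: hom_space_carrier_iff multilinear_maps_def)

text \<open>Supplies the additive group in which cosets of coboundaries are formed.\<close>

lemma abelian_group_hom_space:
  assumes V: "module K V" and W: "module K W"
  shows "abelian_group (hom_space K T n V W)"
proof -
  interpret W: module K W by fact
  let ?C = "hom_space K T n V W"
  have add: "f \<oplus>\<^bsub>?C\<^esub> g \<in> carrier ?C" if "f \<in> carrier ?C" "g \<in> carrier ?C" for f g
  proof -
    have "(\<lambda>r\<in>U T n. \<lambda>as\<in>nlists n (carrier V). f r as \<oplus>\<^bsub>W\<^esub> g r as) \<in> carrier ?C"
      using that by (intro hom_space_restrictI[OF V])
        (auto intro!: linear_map_sum[OF W] W.a_closed intro: hom_space_closed hom_space_linear)
    then show ?thesis by (simp add: hom_space_def)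
  qed
  have zero: "\<zero>\<^bsub>?C\<^esub> \<in> carrier ?C"
  proof -
    have "(\<lambda>r\<in>U T n. \<lambda>as\<in>nlists n (carrier V). \<zero>\<^bsub>W\<^esub>) \<in> carrier ?C"
      by (intro hom_space_restrictI[OF V]) (auto intro: linear_map_zero_map[OF W])
    then show ?thesis by (simp add: hom_space_def)
  qed
  have neg: "\<exists>g\<in>carrier ?C. g \<oplus>\<^bsub>?C\<^esub> f = \<zero>\<^bsub>?C\<^esub>" if "f \<in> carrier ?C" for f
  proof
    let ?g = "\<lambda>r\<in>U T n. \<lambda>as\<in>nlists n (carrier V). \<ominus>\<^bsub>W\<^esub> f r as"
    show g: "?g \<in> carrier ?C"
      using that by (intro hom_space_restrictI[OF V])
        (auto intro!: linear_map_uminus[OF W] W.a_inv_closed intro: hom_space_closed hom_space_linear)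
    show "?g \<oplus>\<^bsub>?C\<^esub> f = \<zero>\<^bsub>?C\<^esub>"
      using that g add zero
      by (intro hom_space_eqI[where f="?g \<oplus>\<^bsub>?C\<^esub> f"])
         (auto simp: hom_space_add_apply hom_space_zero_apply W.l_neg hom_space_closed)
  qed
  show ?thesis
  proof (rule abelian_groupI)
    fix f g h assume fgh: "f \<in> carrier ?C" "g \<in> carrier ?C" "h \<in> carrier ?C"
    show "f \<oplus>\<^bsub>?C\<^esub> g \<oplus>\<^bsub>?C\<^esub> h = f \<oplus>\<^bsub>?C\<^esub> (g \<oplus>\<^bsub>?C\<^esub> h)"
      using fgh by (intro hom_space_eqI[OF add add])
        (auto simp: add hom_space_add_apply hom_space_closed W.a_assoc)
    show "f \<oplus>\<^bsub>?C\<^esub> g = g \<oplus>\<^bsub>?C\<^esub> f"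
      using fgh by (intro hom_space_eqI[OF add add])
        (auto simp: hom_space_add_apply hom_space_closed W.a_comm)
    show "\<zero>\<^bsub>?C\<^esub> \<oplus>\<^bsub>?C\<^esub> f = f"
      using fgh zero by (intro hom_space_eqI[OF add])
        (auto simp: hom_space_add_apply hom_space_zero_apply hom_space_closed)
  qed (use add zero neg in auto)
qed

text \<open>\<open>cochain1\<close> and \<open>cochain2\<close> translate curried maps into the
  encoding of \<open>hom_space\<close>, where arguments are lists and functions are
  extensional.\<close>

definition cochain1 :: "('r, 'k) type_data \<Rightarrow> ('k, 'a) module \<Rightarrow> ('a \<Rightarrow> 'b) \<Rightarrow> 'r \<Rightarrow> 'a list \<Rightarrow> 'b" where
  "cochain1 T V h = (\<lambda>r\<in>U T 1. \<lambda>as\<in>nlists 1 (carrier V). h (as ! 0))"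

definition cochain2 :: "('r, 'k) type_data \<Rightarrow> ('k, 'a) module \<Rightarrow> ('r \<Rightarrow> 'a \<Rightarrow> 'a \<Rightarrow> 'b) \<Rightarrow> 'r \<Rightarrow> 'a list \<Rightarrow> 'b" where
  "cochain2 T V \<phi> = (\<lambda>r\<in>U T 2. \<lambda>as\<in>nlists 2 (carrier V). \<phi> r (as ! 0) (as ! 1))"

lemma cochain1_apply [simp]: "r \<in> U T 1 \<Longrightarrow> a \<in> carrier V \<Longrightarrow> cochain1 T V h r [a] = h a"
  by (simp add: cochain1_def nlists_1_iff)

lemma cochain2_apply [simp]:
  "r \<in> U T 2 \<Longrightarrow> a \<in> carrier V \<Longrightarrow> b \<in> carrier V \<Longrightarrow> cochain2 T V \<phi> r [a, b] = \<phi> r a b"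
  by (simp add: cochain2_def nlists_2_iff)

lemma cochain1_in_hom_space:
  assumes "module K V" "linear_map K V W h"
  shows "cochain1 T V h \<in> carrier (hom_space K T 1 V W)"
  unfolding cochain1_def using assms
  by (intro hom_space_restrictI) (auto simp: nlists_1_iff intro: linear_map_closed)

lemma cochain2_in_hom_space:
  assumes "module K V" "\<And>r. r \<in> U T 2 \<Longrightarrow> bilinear_map K V V W (\<phi> r)"
  shows "cochain2 T V \<phi> \<in> carrier (hom_space K T 2 V W)"
  unfolding cochain2_def using assms(1)
  by (intro hom_space_restrictI)
     (auto simp: nlists_2_iff less_2_cases_iff
           intro: bilinear_map_closed[OF assms(2)] bilinear_map_left[OF assms(2)] bilinear_map_right[OF assms(2)])

text \<open>Multilinearity is stated by varying one entry of an existing list, so some vector is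
  needed to form such a list.\<close>

lemma hom_space_1_linear:
  assumes "f \<in> carrier (hom_space K T 1 V W)" "r \<in> U T 1" "carrier V \<noteq> {}"
  shows "linear_map K V W (\<lambda>a. f r [a])"
proof -
  obtain v where "v \<in> carrier V" using assms(3) by blast
  then show ?thesis
    using hom_space_linear[OF assms(1,2), of "[v]" 0] by (simp add: nlists_1_iff)
qed

lemma hom_space_2_bilinear:
  assumes "f \<in> carrier (hom_space K T 2 V W)" "r \<in> U T 2"
  shows "bilinear_map K V V W (\<lambda>a b. f r [a, b])"
proof (rule bilinear_mapI)
  fix x assume "x \<in> carrier V"
  \<comment> \<open>Updating \<open>[x, x]\<close> at index 1 gives \<open>[x, b]\<close> and at
    index 0 gives \<open>[a, x]\<close>, so one list serves both arguments.\<close>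
  then have "[x, x] \<in> nlists 2 (carrier V)" by (simp add: nlists_2_iff)
  then show "linear_map K V W (\<lambda>b. f r [x, b])" "linear_map K V W (\<lambda>a. f r [a, x])"
    using hom_space_linear[OF assms, of "[x, x]" 1] hom_space_linear[OF assms, of "[x, x]" 0]
    by (simp_all add: numeral_2_eq_2)
qed

lemma hom_space_2_closed:
  "f \<in> carrier (hom_space K T 2 V W) \<Longrightarrow> r \<in> U T 2 \<Longrightarrow> a \<in> carrier V \<Longrightarrow> b \<in> carrier V
     \<Longrightarrow> f r [a, b] \<in> carrier W"
  by (simp add: hom_space_closed nlists_2_iff)

lemma hom_space_2_eqI:
  assumes "f \<in> carrier (hom_space K T 2 V W)" "g \<in> carrier (hom_space K T 2 V W)"
    and "\<And>r a b. r \<in> U T 2 \<Longrightarrow> a \<in> carrier V \<Longrightarrow> b \<in> carrier V \<Longrightarrow> f r [a, b] = g r [a, b]"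
  shows "f = g"
  using assms(1,2) by (rule hom_space_eqI) (auto simp: nlists_2_iff assms(3))

lemma restrict_eq_iff: "restrict f S = restrict g S \<longleftrightarrow> (\<forall>x\<in>S. f x = g x)"
  by (metis restrict_apply' restrict_ext)

text \<open>Both composites are restricted to the same domain, of arity
  \<open>2 + 2 - 1 = 3\<close>, so their equality is pointwise. This is the form in which
  associativity is used below.\<close>

lemma pcomp_2_2_eq_iff:
  fixes g :: "'r \<Rightarrow> 'a list \<Rightarrow> 'a"
  shows "pcomp K T V 2 1 2 g g = pcomp K T V 2 2 2 g g \<longleftrightarrow>
    (\<forall>y\<in>U T 3. \<forall>a\<in>carrier V. \<forall>b\<in>carrier V. \<forall>c\<in>carrier V.
       g (R0 T 2 1 2 y) [lin_ext K V (\<lambda>s. g s [a, b]) (Rs T 2 1 2 y), c]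
       = g (R0 T 2 2 2 y) [a, lin_ext K V (\<lambda>s. g s [b, c]) (Rs T 2 2 2 y)])"
  by (simp add: pcomp_def restrict_eq_iff ball_nlists_3)

section \<open>Direct sums encoded in a given type\<close>

locale module_sum =
  fixes K :: "'k ring" and A :: "('k, 'a) module" and M :: "('k, 'b) module"
    and enc :: "'a \<times> 'b \<Rightarrow> 'e"
  assumes module_A: "module K A" and module_M: "module K M"
    and inj_enc: "inj_on enc (carrier A \<times> carrier M)"
begin

sublocale A: module K A by (rule module_A)
sublocale M: module K M by (rule module_M)

definition pA :: "'e \<Rightarrow> 'a" where "pA e = fst (inv_into (carrier A \<times> carrier M) enc e)"
definition pM :: "'e \<Rightarrow> 'b" where "pM e = snd (inv_into (carrier A \<times> carrier M) enc e)"

text \<open>The operations decode, act in each component and encode again; injectivity of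
  \<open>enc\<close> on the pairs makes this a copy of the direct sum inside the type
  \<open>'e\<close>.\<close>

definition E :: "('k, 'e) module" where
  "E = \<lparr> carrier = enc ` (carrier A \<times> carrier M), monoid.mult = undefined, monoid.one = undefined,
         ring.zero = enc (\<zero>\<^bsub>A\<^esub>, \<zero>\<^bsub>M\<^esub>),
         ring.add = (\<lambda>x y. enc (pA x \<oplus>\<^bsub>A\<^esub> pA y, pM x \<oplus>\<^bsub>M\<^esub> pM y)),
         smult = (\<lambda>c x. enc (c \<odot>\<^bsub>A\<^esub> pA x, c \<odot>\<^bsub>M\<^esub> pM x)) \<rparr>"

lemma pA_enc [simp]: "a \<in> carrier A \<Longrightarrow> m \<in> carrier M \<Longrightarrow> pA (enc (a, m)) = a"
  and pM_enc [simp]: "a \<in> carrier A \<Longrightarrow> m \<in> carrier M \<Longrightarrow> pM (enc (a, m)) = m"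
  by (simp_all add: pA_def pM_def inv_into_f_f[OF inj_enc])

lemma enc_closed [simp]: "a \<in> carrier A \<Longrightarrow> m \<in> carrier M \<Longrightarrow> enc (a, m) \<in> carrier E"
  by (simp add: E_def)

lemma enc_cases:
  assumes "e \<in> carrier E"
  obtains a m where "a \<in> carrier A" "m \<in> carrier M" "e = enc (a, m)"
  using assms by (auto simp: E_def)

lemma pA_closed [simp]: "e \<in> carrier E \<Longrightarrow> pA e \<in> carrier A"
  and pM_closed [simp]: "e \<in> carrier E \<Longrightarrow> pM e \<in> carrier M"
  and enc_pA_pM: "e \<in> carrier E \<Longrightarrow> enc (pA e, pM e) = e"
  by (auto elim: enc_cases)

lemma enc_eq_iff:
  "a \<in> carrier A \<Longrightarrow> m \<in> carrier M \<Longrightarrow> b \<in> carrier A \<Longrightarrow> n \<in> carrier M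
     \<Longrightarrow> enc (a, m) = enc (b, n) \<longleftrightarrow> a = b \<and> m = n"
  by (metis pA_enc pM_enc)

lemma E_eqI: "x \<in> carrier E \<Longrightarrow> y \<in> carrier E \<Longrightarrow> pA x = pA y \<Longrightarrow> pM x = pM y \<Longrightarrow> x = y"
  by (metis enc_pA_pM)

lemma zero_E: "\<zero>\<^bsub>E\<^esub> = enc (\<zero>\<^bsub>A\<^esub>, \<zero>\<^bsub>M\<^esub>)"
  and add_E: "x \<oplus>\<^bsub>E\<^esub> y = enc (pA x \<oplus>\<^bsub>A\<^esub> pA y, pM x \<oplus>\<^bsub>M\<^esub> pM y)"
  and smult_E: "c \<odot>\<^bsub>E\<^esub> x = enc (c \<odot>\<^bsub>A\<^esub> pA x, c \<odot>\<^bsub>M\<^esub> pM x)"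
  by (simp_all add: E_def)

lemma module_E: "module K E"
proof (rule moduleI)
  show "abelian_group E"
  proof (rule abelian_groupI)
    fix x assume x: "x \<in> carrier E"
    have "enc (\<ominus>\<^bsub>A\<^esub> pA x, \<ominus>\<^bsub>M\<^esub> pM x) \<oplus>\<^bsub>E\<^esub> x = \<zero>\<^bsub>E\<^esub>"
      using x by (simp add: add_E zero_E A.l_neg M.l_neg)
    then show "\<exists>y\<in>carrier E. y \<oplus>\<^bsub>E\<^esub> x = \<zero>\<^bsub>E\<^esub>"
      using x by (intro bexI[of _ "enc (\<ominus>\<^bsub>A\<^esub> pA x, \<ominus>\<^bsub>M\<^esub> pM x)"]) simp_all
  qed (simp_all add: add_E zero_E A.a_ac M.a_ac enc_pA_pM)
qed (simp_all add: A.is_cring add_E smult_E A.smult_l_distr M.smult_l_distr A.smult_r_distr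
      M.smult_r_distr A.smult_assoc1 M.smult_assoc1 enc_pA_pM)

sublocale E: module K E by (rule module_E)

lemma linear_pA: "linear_map K E A pA"
  by (rule linear_mapI) (simp_all add: add_E smult_E)

lemma linear_pM: "linear_map K E M pM"
  by (rule linear_mapI) (simp_all add: add_E smult_E)

text \<open>The universal property of the direct sum as a product.\<close>

lemma linear_enc:
  assumes "linear_map K V A g" "linear_map K V M h"
  shows "linear_map K V E (\<lambda>x. enc (g x, h x))"
  by (rule linear_mapI)
     (simp_all add: add_E smult_E linear_map_closed[OF assms(1)] linear_map_closed[OF assms(2)]
        linear_map_add[OF assms(1)] linear_map_add[OF assms(2)]
        linear_map_smult[OF assms(1)] linear_map_smult[OF assms(2)])

lemma bilinear_enc:
  assumes "bilinear_map K V V' A g" "bilinear_map K V V' M h"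
  shows "bilinear_map K V V' E (\<lambda>x y. enc (g x y, h x y))"
  using assms by (auto simp: bilinear_map_def intro: linear_enc)

text \<open>The two projections are linear, hence commute with linear extension, and a vector of
  \<open>E\<close> is determined by its projections.\<close>

lemma lin_ext_enc:
  assumes "x \<in> free_vectors K S" "\<phi> \<in> S \<rightarrow> carrier A" "\<psi> \<in> S \<rightarrow> carrier M"
  shows "lin_ext K E (\<lambda>s. enc (\<phi> s, \<psi> s)) x = enc (lin_ext K A \<phi> x, lin_ext K M \<psi> x)"
proof (rule E_eqI)
  have en: "(\<lambda>s. enc (\<phi> s, \<psi> s)) \<in> S \<rightarrow> carrier E"
    using assms by (simp add: Pi_iff)
  have cl: "lin_ext K A \<phi> x \<in> carrier A" "lin_ext K M \<psi> x \<in> carrier M"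
    using assms by (auto intro!: lin_ext_in_carrier module_A module_M)
  show "lin_ext K E (\<lambda>s. enc (\<phi> s, \<psi> s)) x \<in> carrier E"
    by (rule lin_ext_in_carrier[OF module_E assms(1) en])
  show "enc (lin_ext K A \<phi> x, lin_ext K M \<psi> x) \<in> carrier E"
    using cl by simp
  have "pA (lin_ext K E (\<lambda>s. enc (\<phi> s, \<psi> s)) x) = lin_ext K A (\<lambda>s. pA (enc (\<phi> s, \<psi> s))) x"
    by (rule linear_map_lin_ext[OF module_E module_A linear_pA assms(1) en])
  also have "\<dots> = lin_ext K A \<phi> x"
    using assms(2,3) by (intro lin_ext_cong[OF module_A assms(1,2)]) (auto simp: Pi_iff)
  finally show "pA (lin_ext K E (\<lambda>s. enc (\<phi> s, \<psi> s)) x) = pA (enc (lin_ext K A \<phi> x, lin_ext K M \<psi> x))"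
    using cl by simp
  have "pM (lin_ext K E (\<lambda>s. enc (\<phi> s, \<psi> s)) x) = lin_ext K M (\<lambda>s. pM (enc (\<phi> s, \<psi> s))) x"
    by (rule linear_map_lin_ext[OF module_E module_M linear_pM assms(1) en])
  also have "\<dots> = lin_ext K M \<psi> x"
    using assms(2,3) by (intro lin_ext_cong[OF module_M assms(1,3)]) (auto simp: Pi_iff)
  finally show "pM (lin_ext K E (\<lambda>s. enc (\<phi> s, \<psi> s)) x) = pM (enc (lin_ext K A \<phi> x, lin_ext K M \<psi> x))"
    using cl by simp
qed

end

section \<open>Twisted multiplications\<close>

text \<open>The coding \<open>enc\<close> is an arbitrary parameter here; its existence is a
  separate question about the size of the universe, settled at the end.\<close>

locale loday_module = module_sum K A M enc
  for K :: "'k ring" and A M :: "('k, 'u) module" and enc :: "'u \<times> 'u \<Rightarrow> 'u" +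
  fixes T :: "('r, 'k) type_data" and mul :: "'r \<Rightarrow> 'u list \<Rightarrow> 'u"
    and \<theta>1 \<theta>2 :: "'r \<Rightarrow> 'u \<Rightarrow> 'u \<Rightarrow> 'u"
  assumes type: "loday_type TYPE('u) K T" and U1: "card (U T 1) = 1"
    and alg: "loday_algebra K T A mul"
    and rep: "loday_representation K T A mul M \<theta>1 \<theta>2"
begin

lemma R0_closed: "1 \<le> i \<Longrightarrow> i \<le> m \<Longrightarrow> 1 \<le> n \<Longrightarrow> y \<in> U T (m + n - 1) \<Longrightarrow> R0 T m i n y \<in> U T m"
  and Rs_closed: "1 \<le> i \<Longrightarrow> i \<le> m \<Longrightarrow> 1 \<le> n \<Longrightarrow> y \<in> U T (m + n - 1)
         \<Longrightarrow> Rs T m i n y \<in> free_vectors K (U T n)"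
  and operad: "module K V \<Longrightarrow> ns_operad K (\<lambda>n. hom_space K T n V V) (pcomp K T V) (pident T V)"
  for V :: "('k, 'u) module"
  using type unfolding loday_type_def by blast+

lemma R_closed_3:
  assumes "y \<in> U T 3"
  shows "R0 T 2 1 2 y \<in> U T 2" "R0 T 2 2 2 y \<in> U T 2"
    "Rs T 2 1 2 y \<in> free_vectors K (U T 2)" "Rs T 2 2 2 y \<in> free_vectors K (U T 2)"
  using R0_closed[of 1 2 2 y] R0_closed[of 2 2 2 y] Rs_closed[of 1 2 2 y] Rs_closed[of 2 2 2 y] assms
  by simp_all

text \<open>These are the indices met in the coboundary of a 1-cochain: a unary operation plugged
  into a binary one at either place, and a binary one plugged into a unary one, since
  \<open>2 + 1 - 1 = 1 + 2 - 1 = 2\<close>.\<close>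

lemma R_closed_2:
  assumes "r \<in> U T 2"
  shows "R0 T 2 1 1 r \<in> U T 2" "R0 T 2 2 1 r \<in> U T 2" "R0 T 1 1 2 r \<in> U T 1"
    "Rs T 2 1 1 r \<in> free_vectors K (U T 1)" "Rs T 2 2 1 r \<in> free_vectors K (U T 1)"
    "Rs T 1 1 2 r \<in> free_vectors K (U T 2)"
  using R0_closed[of 1 2 1 r] R0_closed[of 2 2 1 r] R0_closed[of 1 1 2 r]
    Rs_closed[of 1 2 1 r] Rs_closed[of 2 2 1 r] Rs_closed[of 1 1 2 r] assms
  by (simp_all del: One_nat_def)

abbreviation "C n \<equiv> hom_space K T n A M"

lemma mul_in: "mul \<in> carrier (hom_space K T 2 A A)"
  and mul_assoc: "pcomp K T A 2 1 2 mul mul = pcomp K T A 2 2 2 mul mul"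
  using alg by (simp_all add: loday_algebra_def operad_multiplication_def)

lemma mul_closed: "r \<in> U T 2 \<Longrightarrow> a \<in> carrier A \<Longrightarrow> b \<in> carrier A \<Longrightarrow> mul r [a, b] \<in> carrier A"
  by (rule hom_space_2_closed[OF mul_in])

lemma mul_bilinear: "r \<in> U T 2 \<Longrightarrow> bilinear_map K A A A (\<lambda>a b. mul r [a, b])"
  by (rule hom_space_2_bilinear[OF mul_in])

lemma \<theta>1_bilinear: "r \<in> U T 2 \<Longrightarrow> bilinear_map K A M M (\<theta>1 r)"
  and \<theta>2_bilinear: "r \<in> U T 2 \<Longrightarrow> bilinear_map K M A M (\<theta>2 r)"
  using rep by (simp_all add: loday_representation_def)

lemma \<theta>1_closed: "r \<in> U T 2 \<Longrightarrow> a \<in> carrier A \<Longrightarrow> m \<in> carrier M \<Longrightarrow> \<theta>1 r a m \<in> carrier M"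
  and \<theta>2_closed: "r \<in> U T 2 \<Longrightarrow> a \<in> carrier A \<Longrightarrow> m \<in> carrier M \<Longrightarrow> \<theta>2 r m a \<in> carrier M"
  by (blast intro: bilinear_map_closed \<theta>1_bilinear \<theta>2_bilinear)+

lemma \<theta>1_add: "r \<in> U T 2 \<Longrightarrow> a \<in> carrier A \<Longrightarrow> m \<in> carrier M \<Longrightarrow> n \<in> carrier M
    \<Longrightarrow> \<theta>1 r a (m \<oplus>\<^bsub>M\<^esub> n) = \<theta>1 r a m \<oplus>\<^bsub>M\<^esub> \<theta>1 r a n"
  and \<theta>2_add: "r \<in> U T 2 \<Longrightarrow> a \<in> carrier A \<Longrightarrow> m \<in> carrier M \<Longrightarrow> n \<in> carrier M
    \<Longrightarrow> \<theta>2 r (m \<oplus>\<^bsub>M\<^esub> n) a = \<theta>2 r m a \<oplus>\<^bsub>M\<^esub> \<theta>2 r n a"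
  using linear_map_add[OF bilinear_map_right[OF \<theta>1_bilinear]]
    linear_map_add[OF bilinear_map_left[OF \<theta>2_bilinear]] by simp_all

lemma \<theta>1_zero:
  "r \<in> U T 2 \<Longrightarrow> a \<in> carrier A \<Longrightarrow> \<theta>1 r a \<zero>\<^bsub>M\<^esub> = \<zero>\<^bsub>M\<^esub>"
  "r \<in> U T 2 \<Longrightarrow> m \<in> carrier M \<Longrightarrow> \<theta>1 r \<zero>\<^bsub>A\<^esub> m = \<zero>\<^bsub>M\<^esub>"
  and \<theta>2_zero:
  "r \<in> U T 2 \<Longrightarrow> a \<in> carrier A \<Longrightarrow> \<theta>2 r \<zero>\<^bsub>M\<^esub> a = \<zero>\<^bsub>M\<^esub>"
  "r \<in> U T 2 \<Longrightarrow> m \<in> carrier M \<Longrightarrow> \<theta>2 r m \<zero>\<^bsub>A\<^esub> = \<zero>\<^bsub>M\<^esub>"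
  using linear_map_zero[OF module_M module_M bilinear_map_right[OF \<theta>1_bilinear]]
    linear_map_zero[OF module_A module_M bilinear_map_left[OF \<theta>1_bilinear]]
    linear_map_zero[OF module_A module_M bilinear_map_right[OF \<theta>2_bilinear]]
    linear_map_zero[OF module_M module_M bilinear_map_left[OF \<theta>2_bilinear]] by simp_all

lemma mul_zero:
  "r \<in> U T 2 \<Longrightarrow> a \<in> carrier A \<Longrightarrow> mul r [a, \<zero>\<^bsub>A\<^esub>] = \<zero>\<^bsub>A\<^esub>"
  "r \<in> U T 2 \<Longrightarrow> a \<in> carrier A \<Longrightarrow> mul r [\<zero>\<^bsub>A\<^esub>, a] = \<zero>\<^bsub>A\<^esub>"
  using linear_map_zero[OF module_A module_A bilinear_map_right[OF mul_bilinear]]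
    linear_map_zero[OF module_A module_A bilinear_map_left[OF mul_bilinear]] by simp_all

lemma cochain_zero:
  assumes "z \<in> carrier (C 2)" "r \<in> U T 2" "a \<in> carrier A"
  shows "z r [a, \<zero>\<^bsub>A\<^esub>] = \<zero>\<^bsub>M\<^esub>" "z r [\<zero>\<^bsub>A\<^esub>, a] = \<zero>\<^bsub>M\<^esub>"
  using linear_map_zero[OF module_A module_M bilinear_map_right[OF hom_space_2_bilinear[OF assms(1,2)] assms(3)]]
    linear_map_zero[OF module_A module_M bilinear_map_left[OF hom_space_2_bilinear[OF assms(1,2)] assms(3)]]
  by simp_all

text \<open>There is no term pairing \<open>pM x\<close> with \<open>pM y\<close>: the copy of
  \<open>M\<close> multiplies to zero, as an abelian extension demands. With \<open>z = 0\<close>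
  this is the semidirect product.\<close>

definition tmul :: "('r \<Rightarrow> 'u list \<Rightarrow> 'u) \<Rightarrow> 'r \<Rightarrow> 'u list \<Rightarrow> 'u" where
  "tmul z = cochain2 T E (\<lambda>r x y. enc (mul r [pA x, pA y],
     \<theta>1 r (pA x) (pM y) \<oplus>\<^bsub>M\<^esub> \<theta>2 r (pM x) (pA y) \<oplus>\<^bsub>M\<^esub> z r [pA x, pA y]))"

lemma tmul_enc:
  assumes "r \<in> U T 2" "a \<in> carrier A" "m \<in> carrier M" "b \<in> carrier A" "n \<in> carrier M"
  shows "tmul z r [enc (a, m), enc (b, n)]
    = enc (mul r [a, b], \<theta>1 r a n \<oplus>\<^bsub>M\<^esub> \<theta>2 r m b \<oplus>\<^bsub>M\<^esub> z r [a, b])"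
  using assms by (simp add: tmul_def)

lemma tmul_in:
  assumes z: "z \<in> carrier (C 2)"
  shows "tmul z \<in> carrier (hom_space K T 2 E E)"
  unfolding tmul_def
proof (rule cochain2_in_hom_space[OF module_E])
  fix r assume r: "r \<in> U T 2"
  note b = bilinear_map_compose[OF _ _ _ linear_map_id]
  show "bilinear_map K E E E (\<lambda>x y. enc (mul r [pA x, pA y],
     \<theta>1 r (pA x) (pM y) \<oplus>\<^bsub>M\<^esub> \<theta>2 r (pM x) (pA y) \<oplus>\<^bsub>M\<^esub> z r [pA x, pA y]))"
    by (intro bilinear_enc bilinear_map_sum[OF module_M]
          b[OF mul_bilinear[OF r] linear_pA linear_pA] b[OF \<theta>1_bilinear[OF r] linear_pA linear_pM]
          b[OF \<theta>2_bilinear[OF r] linear_pM linear_pA]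
          b[OF hom_space_2_bilinear[OF z r] linear_pA linear_pA])
qed

text \<open>The equation saying that the coboundary of \<open>z\<close> vanishes at \<open>y\<close>
  and \<open>a, b, c\<close>, with the negative terms moved to the left. In this shape it comes out
  of the associativity of \<open>tmul z\<close>.\<close>

definition cocycle_at :: "('r \<Rightarrow> 'u list \<Rightarrow> 'u) \<Rightarrow> 'r \<Rightarrow> 'u \<Rightarrow> 'u \<Rightarrow> 'u \<Rightarrow> bool" where
  "cocycle_at z y a b c \<longleftrightarrow>
     \<theta>2 (R0 T 2 1 2 y) (lin_ext K M (\<lambda>s. z s [a, b]) (Rs T 2 1 2 y)) c
       \<oplus>\<^bsub>M\<^esub> z (R0 T 2 1 2 y) [lin_ext K A (\<lambda>s. mul s [a, b]) (Rs T 2 1 2 y), c]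
     = \<theta>1 (R0 T 2 2 2 y) a (lin_ext K M (\<lambda>s. z s [b, c]) (Rs T 2 2 2 y))
       \<oplus>\<^bsub>M\<^esub> z (R0 T 2 2 2 y) [a, lin_ext K A (\<lambda>s. mul s [b, c]) (Rs T 2 2 2 y)]"

definition cocycle :: "('r \<Rightarrow> 'u list \<Rightarrow> 'u) \<Rightarrow> bool" where
  "cocycle z \<longleftrightarrow> (\<forall>y\<in>U T 3. \<forall>a\<in>carrier A. \<forall>b\<in>carrier A. \<forall>c\<in>carrier A. cocycle_at z y a b c)"

text \<open>In an iterated product the inner factor is indexed by a vector of \<open>K[U 2]\<close>
  and not by an index. Linear extension works componentwise and is additive, so the three
  \<open>M\<close>-terms separate.\<close>

lemma lin_ext_tmul:
  assumes "z \<in> carrier (C 2)" "x \<in> free_vectors K (U T 2)"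
    "a \<in> carrier A" "m \<in> carrier M" "b \<in> carrier A" "n \<in> carrier M"
  shows "lin_ext K E (\<lambda>s. tmul z s [enc (a, m), enc (b, n)]) x
    = enc (lin_ext K A (\<lambda>s. mul s [a, b]) x,
           lin_ext K M (\<lambda>s. \<theta>1 s a n) x \<oplus>\<^bsub>M\<^esub> lin_ext K M (\<lambda>s. \<theta>2 s m b) x
           \<oplus>\<^bsub>M\<^esub> lin_ext K M (\<lambda>s. z s [a, b]) x)"
proof -
  have cl: "(\<lambda>s. mul s [a, b]) \<in> U T 2 \<rightarrow> carrier A"
    "(\<lambda>s. \<theta>1 s a n) \<in> U T 2 \<rightarrow> carrier M" "(\<lambda>s. \<theta>2 s m b) \<in> U T 2 \<rightarrow> carrier M"
    "(\<lambda>s. z s [a, b]) \<in> U T 2 \<rightarrow> carrier M"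
    "(\<lambda>s. \<theta>1 s a n \<oplus>\<^bsub>M\<^esub> \<theta>2 s m b) \<in> U T 2 \<rightarrow> carrier M"
    "(\<lambda>s. \<theta>1 s a n \<oplus>\<^bsub>M\<^esub> \<theta>2 s m b \<oplus>\<^bsub>M\<^esub> z s [a, b]) \<in> U T 2 \<rightarrow> carrier M"
    using assms by (auto simp: mul_closed \<theta>1_closed \<theta>2_closed hom_space_2_closed[OF assms(1)])
  have "lin_ext K E (\<lambda>s. tmul z s [enc (a, m), enc (b, n)]) x
    = lin_ext K E (\<lambda>s. enc (mul s [a, b], \<theta>1 s a n \<oplus>\<^bsub>M\<^esub> \<theta>2 s m b \<oplus>\<^bsub>M\<^esub> z s [a, b])) x"
    using assms cl by (intro lin_ext_cong[OF module_E assms(2)]) (auto simp: tmul_enc Pi_iff)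
  also have "\<dots> = enc (lin_ext K A (\<lambda>s. mul s [a, b]) x,
      lin_ext K M (\<lambda>s. \<theta>1 s a n \<oplus>\<^bsub>M\<^esub> \<theta>2 s m b \<oplus>\<^bsub>M\<^esub> z s [a, b]) x)"
    by (rule lin_ext_enc[OF assms(2) cl(1,6)])
  also have "lin_ext K M (\<lambda>s. \<theta>1 s a n \<oplus>\<^bsub>M\<^esub> \<theta>2 s m b \<oplus>\<^bsub>M\<^esub> z s [a, b]) x
     = lin_ext K M (\<lambda>s. \<theta>1 s a n) x \<oplus>\<^bsub>M\<^esub> lin_ext K M (\<lambda>s. \<theta>2 s m b) x
           \<oplus>\<^bsub>M\<^esub> lin_ext K M (\<lambda>s. z s [a, b]) x"
    by (simp add: lin_ext_add[OF module_M assms(2) cl(5,4)] lin_ext_add[OF module_M assms(2) cl(2,3)])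
  finally show ?thesis .
qed

text \<open>The terms not involving \<open>z\<close> cancel by the three axioms of a representation.\<close>

lemma tmul_assoc_at_iff:
  assumes z: "z \<in> carrier (C 2)" and y: "y \<in> U T 3"
    and a: "a \<in> carrier A" and b: "b \<in> carrier A" and c: "c \<in> carrier A"
    and m: "m \<in> carrier M" and n: "n \<in> carrier M" and p: "p \<in> carrier M"
  shows "tmul z (R0 T 2 1 2 y)
           [lin_ext K E (\<lambda>s. tmul z s [enc (a, m), enc (b, n)]) (Rs T 2 1 2 y), enc (c, p)]
       = tmul z (R0 T 2 2 2 y)
           [enc (a, m), lin_ext K E (\<lambda>s. tmul z s [enc (b, n), enc (c, p)]) (Rs T 2 2 2 y)]
     \<longleftrightarrow> cocycle_at z y a b c"
proof -
  note R = R_closed_3[OF y]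
  let ?R = "R0 T 2 1 2 y" and ?Q = "R0 T 2 2 2 y"
  let ?L = "\<lambda>f. lin_ext K M f (Rs T 2 1 2 y)" and ?N = "\<lambda>f. lin_ext K M f (Rs T 2 2 2 y)"
  define ab where "ab = lin_ext K A (\<lambda>s. mul s [a, b]) (Rs T 2 1 2 y)"
  define bc where "bc = lin_ext K A (\<lambda>s. mul s [b, c]) (Rs T 2 2 2 y)"
  have abc: "ab \<in> carrier A" "bc \<in> carrier A"
    unfolding ab_def bc_def using R a b c
    by (auto intro!: lin_ext_in_carrier[OF module_A] simp: mul_closed)
  have L: "?L (\<lambda>s. \<theta>1 s a n) \<in> carrier M" "?L (\<lambda>s. \<theta>2 s m b) \<in> carrier M" "?L (\<lambda>s. z s [a, b]) \<in> carrier M"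
    "?N (\<lambda>s. \<theta>1 s b p) \<in> carrier M" "?N (\<lambda>s. \<theta>2 s n c) \<in> carrier M" "?N (\<lambda>s. z s [b, c]) \<in> carrier M"
    using R a b c m n p
    by (auto intro!: lin_ext_in_carrier[OF module_M] simp: \<theta>1_closed \<theta>2_closed hom_space_2_closed[OF z])
  have zc: "z ?R [ab, c] \<in> carrier M" "z ?Q [a, bc] \<in> carrier M"
    using R abc a c by (auto intro: hom_space_2_closed[OF z])
  have "mul ?R [ab, c] = mul ?Q [a, bc]"
    using mul_assoc y a b c unfolding pcomp_2_2_eq_iff ab_def bc_def by blast
  \<comment> \<open>The three axioms are associativity with the element of \<open>M\<close> in the
    third, first and second place respectively.\<close>
  moreover have "\<theta>1 ?Q a (?N (\<lambda>s. \<theta>1 s b p)) = \<theta>1 ?R ab p"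
    "\<theta>2 ?Q m bc = \<theta>2 ?R (?L (\<lambda>s. \<theta>2 s m b)) c"
    "\<theta>1 ?Q a (?N (\<lambda>s. \<theta>2 s n c)) = \<theta>2 ?R (?L (\<lambda>s. \<theta>1 s a n)) c"
    using rep y a b c m n p unfolding loday_representation_def ab_def bc_def by blast+
  moreover have "tmul z ?R [lin_ext K E (\<lambda>s. tmul z s [enc (a, m), enc (b, n)]) (Rs T 2 1 2 y), enc (c, p)]
     = enc (mul ?R [ab, c], \<theta>1 ?R ab p \<oplus>\<^bsub>M\<^esub> (\<theta>2 ?R (?L (\<lambda>s. \<theta>1 s a n)) c
         \<oplus>\<^bsub>M\<^esub> \<theta>2 ?R (?L (\<lambda>s. \<theta>2 s m b)) c \<oplus>\<^bsub>M\<^esub> \<theta>2 ?R (?L (\<lambda>s. z s [a, b])) c) \<oplus>\<^bsub>M\<^esub> z ?R [ab, c])"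
    using L R abc a b c m n p
    by (simp add: lin_ext_tmul[OF z] ab_def[symmetric] tmul_enc \<theta>2_add del: One_nat_def)
  moreover have "tmul z ?Q [enc (a, m), lin_ext K E (\<lambda>s. tmul z s [enc (b, n), enc (c, p)]) (Rs T 2 2 2 y)]
     = enc (mul ?Q [a, bc], (\<theta>1 ?Q a (?N (\<lambda>s. \<theta>1 s b p)) \<oplus>\<^bsub>M\<^esub> \<theta>1 ?Q a (?N (\<lambda>s. \<theta>2 s n c))
         \<oplus>\<^bsub>M\<^esub> \<theta>1 ?Q a (?N (\<lambda>s. z s [b, c]))) \<oplus>\<^bsub>M\<^esub> \<theta>2 ?Q m bc \<oplus>\<^bsub>M\<^esub> z ?Q [a, bc])"
    using L R abc a b c m n p
    by (simp add: lin_ext_tmul[OF z] bc_def[symmetric] tmul_enc \<theta>1_add del: One_nat_def)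
  moreover
  define S where "S = \<theta>1 ?R ab p \<oplus>\<^bsub>M\<^esub> \<theta>2 ?R (?L (\<lambda>s. \<theta>1 s a n)) c \<oplus>\<^bsub>M\<^esub> \<theta>2 ?R (?L (\<lambda>s. \<theta>2 s m b)) c"
  have S: "S \<in> carrier M"
    unfolding S_def using L R abc c p by (simp add: \<theta>1_closed \<theta>2_closed)
  have "\<theta>1 ?R ab p \<oplus>\<^bsub>M\<^esub> (\<theta>2 ?R (?L (\<lambda>s. \<theta>1 s a n)) c
         \<oplus>\<^bsub>M\<^esub> \<theta>2 ?R (?L (\<lambda>s. \<theta>2 s m b)) c \<oplus>\<^bsub>M\<^esub> \<theta>2 ?R (?L (\<lambda>s. z s [a, b])) c) \<oplus>\<^bsub>M\<^esub> z ?R [ab, c]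
      = S \<oplus>\<^bsub>M\<^esub> (\<theta>2 ?R (?L (\<lambda>s. z s [a, b])) c \<oplus>\<^bsub>M\<^esub> z ?R [ab, c])"
    unfolding S_def using L R abc c p zc by (simp add: \<theta>1_closed \<theta>2_closed M.a_assoc)
  moreover have "(\<theta>1 ?R ab p \<oplus>\<^bsub>M\<^esub> \<theta>2 ?R (?L (\<lambda>s. \<theta>1 s a n)) c
         \<oplus>\<^bsub>M\<^esub> \<theta>1 ?Q a (?N (\<lambda>s. z s [b, c]))) \<oplus>\<^bsub>M\<^esub> \<theta>2 ?R (?L (\<lambda>s. \<theta>2 s m b)) c \<oplus>\<^bsub>M\<^esub> z ?Q [a, bc]
      = S \<oplus>\<^bsub>M\<^esub> (\<theta>1 ?Q a (?N (\<lambda>s. z s [b, c])) \<oplus>\<^bsub>M\<^esub> z ?Q [a, bc])"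
    unfolding S_def using L R abc a c p zc by (simp add: \<theta>1_closed \<theta>2_closed M.a_ac)
  moreover have "\<theta>2 ?R (?L (\<lambda>s. z s [a, b])) c \<oplus>\<^bsub>M\<^esub> z ?R [ab, c] \<in> carrier M"
    "\<theta>1 ?Q a (?N (\<lambda>s. z s [b, c])) \<oplus>\<^bsub>M\<^esub> z ?Q [a, bc] \<in> carrier M"
    using L R zc a c by (simp_all add: \<theta>1_closed \<theta>2_closed)
  ultimately show ?thesis
    using S R abc a c
    by (simp add: enc_eq_iff mul_closed cocycle_at_def ab_def[symmetric] bc_def[symmetric] del: One_nat_def)
qed

lemma tmul_assoc_iff:
  assumes z: "z \<in> carrier (C 2)"
  shows "pcomp K T E 2 1 2 (tmul z) (tmul z) = pcomp K T E 2 2 2 (tmul z) (tmul z) \<longleftrightarrow> cocycle z"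
proof
  assume l: "pcomp K T E 2 1 2 (tmul z) (tmul z) = pcomp K T E 2 2 2 (tmul z) (tmul z)"
  show "cocycle z"
    unfolding cocycle_def
  proof (intro ballI)
    \<comment> \<open>The condition does not depend on the \<open>M\<close> components, so
      associativity is evaluated with all of them zero.\<close>
    fix y a b c assume "y \<in> U T 3" "a \<in> carrier A" "b \<in> carrier A" "c \<in> carrier A"
    then show "cocycle_at z y a b c"
      using l[unfolded pcomp_2_2_eq_iff]
        tmul_assoc_at_iff[OF z _ _ _ _ M.zero_closed M.zero_closed M.zero_closed, of y a b c]
      by (meson enc_closed M.zero_closed)
  qed
next
  assume "cocycle z"
  then show "pcomp K T E 2 1 2 (tmul z) (tmul z) = pcomp K T E 2 2 2 (tmul z) (tmul z)"
    unfolding pcomp_2_2_eq_iff cocycle_def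
    by (auto elim!: enc_cases simp: tmul_assoc_at_iff[OF z] simp del: One_nat_def)
qed

end

section \<open>The second cohomology group\<close>

text \<open>The signs with exponent above 1 in the coboundaries of 1-cochains and
  2-cochains.\<close>

lemma (in module) sign_smult:
  assumes "x \<in> carrier M"
  shows "((\<ominus> \<one>) [^] (2::nat)) \<odot>\<^bsub>M\<^esub> x = x"
    "((\<ominus> \<one>) [^] (3::nat)) \<odot>\<^bsub>M\<^esub> x = \<ominus>\<^bsub>M\<^esub> x"
  using assms
  by (simp_all add: numeral_2_eq_2 numeral_3_eq_3 smult_assoc1 smult_l_minus)

lemma pcomp_2_1_1_apply:
  "r \<in> U T 2 \<Longrightarrow> x \<in> carrier V \<Longrightarrow> y \<in> carrier V
    \<Longrightarrow> pcomp K T V 2 1 1 f g r [x, y] = f (R0 T 2 1 1 r) [lin_ext K V (\<lambda>s. g s [x]) (Rs T 2 1 1 r), y]"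
  by (simp add: pcomp_def nlists_2_iff)

lemma pcomp_2_2_1_apply:
  "r \<in> U T 2 \<Longrightarrow> x \<in> carrier V \<Longrightarrow> y \<in> carrier V
    \<Longrightarrow> pcomp K T V 2 2 1 f g r [x, y] = f (R0 T 2 2 1 r) [x, lin_ext K V (\<lambda>s. g s [y]) (Rs T 2 2 1 r)]"
  by (simp add: pcomp_def nlists_2_iff)

lemma pcomp_1_1_2_apply:
  "r \<in> U T 2 \<Longrightarrow> x \<in> carrier V \<Longrightarrow> y \<in> carrier V
    \<Longrightarrow> pcomp K T V 1 1 2 f g r [x, y] = f (R0 T 1 1 2 r) [lin_ext K V (\<lambda>s. g s [x, y]) (Rs T 1 1 2 r)]"
  by (simp add: pcomp_def nlists_2_iff del: One_nat_def)

lemma pcomp_2_1_2_apply: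
  "r \<in> U T 3 \<Longrightarrow> x \<in> carrier V \<Longrightarrow> y \<in> carrier V \<Longrightarrow> z \<in> carrier V
    \<Longrightarrow> pcomp K T V 2 1 2 f g r [x, y, z]
       = f (R0 T 2 1 2 r) [lin_ext K V (\<lambda>s. g s [x, y]) (Rs T 2 1 2 r), z]"
  by (simp add: pcomp_def nlists_3_iff)

lemma pcomp_2_2_2_apply:
  "r \<in> U T 3 \<Longrightarrow> x \<in> carrier V \<Longrightarrow> y \<in> carrier V \<Longrightarrow> z \<in> carrier V
    \<Longrightarrow> pcomp K T V 2 2 2 f g r [x, y, z]
       = f (R0 T 2 2 2 r) [x, lin_ext K V (\<lambda>s. g s [y, z]) (Rs T 2 2 2 r)]"
  by (simp add: pcomp_def nlists_3_iff)

context loday_module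
begin

abbreviation "\<delta> \<equiv> coboundary K T A mul M \<theta>1 \<theta>2"

lemma abelian_group_C: "abelian_group (C n)"
  by (rule abelian_group_hom_space[OF module_A module_M])

text \<open>
  The unit axioms of the operad on \<open>E\<close>, applied to the multiplication with \<open>z = 0\<close>, contain
  unit axioms for the actions on \<open>M\<close>.
\<close>

lemma action_unit:
  assumes r: "r \<in> U T 2" and a: "a \<in> carrier A" and m: "m \<in> carrier M"
  shows "\<theta>1 (R0 T 2 2 1 r) a (lin_ext K M (\<lambda>s. m) (Rs T 2 2 1 r)) = \<theta>1 r a m"
    and "\<theta>2 (R0 T 2 1 1 r) (lin_ext K M (\<lambda>s. m) (Rs T 2 1 1 r)) a = \<theta>2 r m a"
proof -
  note R = R_closed_2[OF r]
  interpret C2: abelian_group "C 2" by (rule abelian_group_C)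
  let ?z = "\<zero>\<^bsub>C 2\<^esub>"
  have z0: "?z r [a, b] = \<zero>\<^bsub>M\<^esub>" if "r \<in> U T 2" "a \<in> carrier A" "b \<in> carrier A" for r a b
    using that by (simp add: hom_space_zero_apply nlists_2_iff)
  have op: "ns_operad K (\<lambda>n. hom_space K T n E E) (pcomp K T E) (pident T E)"
    by (rule operad[OF module_E])
  have eq: "pcomp K T E 2 i 1 (tmul ?z) (pident T E) r xs = tmul ?z r xs" if "i = 1 \<or> i = 2" for i xs
    using op that tmul_in[OF C2.zero_closed] unfolding ns_operad_def by (metis one_le_numeral order_refl)
  \<comment> \<open>The identity operation ignores its index, so inserting it along \<open>x\<close>
    linearly extends a constant, component by component.\<close>
  have L: "lin_ext K E (\<lambda>s. pident T E s [enc (\<zero>\<^bsub>A\<^esub>, m)]) x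
      = enc (lin_ext K A (\<lambda>s. \<zero>\<^bsub>A\<^esub>) x, lin_ext K M (\<lambda>s. m) x)"
    "lin_ext K A (\<lambda>s. \<zero>\<^bsub>A\<^esub>) x \<in> carrier A" "lin_ext K M (\<lambda>s. m) x \<in> carrier M"
    if x: "x \<in> free_vectors K (U T 1)" for x
  proof -
    have "lin_ext K E (\<lambda>s. pident T E s [enc (\<zero>\<^bsub>A\<^esub>, m)]) x = lin_ext K E (\<lambda>s. enc (\<zero>\<^bsub>A\<^esub>, m)) x"
      using m by (intro lin_ext_cong[OF module_E x]) (auto simp: pident_def nlists_1_iff)
    also have "\<dots> = enc (lin_ext K A (\<lambda>s. \<zero>\<^bsub>A\<^esub>) x, lin_ext K M (\<lambda>s. m) x)"
      using m by (intro lin_ext_enc[OF x]) auto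
    finally show "lin_ext K E (\<lambda>s. pident T E s [enc (\<zero>\<^bsub>A\<^esub>, m)]) x
      = enc (lin_ext K A (\<lambda>s. \<zero>\<^bsub>A\<^esub>) x, lin_ext K M (\<lambda>s. m) x)" .
  qed (use m x in \<open>auto intro: lin_ext_in_carrier[OF module_A] lin_ext_in_carrier[OF module_M]\<close>)
  note simps = tmul_enc z0 \<theta>1_zero \<theta>2_zero \<theta>1_closed \<theta>2_closed enc_eq_iff mul_closed
  \<comment> \<open>On \<open>(a, 0)\<close> and \<open>(0, m)\<close> the \<open>\<theta>2\<close>
    term sees the zero of \<open>M\<close> and vanishes, so the \<open>M\<close> component of the
    unit axiom is the claim. The other action is isolated by exchanging the arguments.\<close>
  show "\<theta>1 (R0 T 2 2 1 r) a (lin_ext K M (\<lambda>s. m) (Rs T 2 2 1 r)) = \<theta>1 r a m"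
    using eq[of 2 "[enc (a, \<zero>\<^bsub>M\<^esub>), enc (\<zero>\<^bsub>A\<^esub>, m)]"] r R a m L[OF R(5)]
    by (simp add: pcomp_2_2_1_apply simps del: One_nat_def)
  show "\<theta>2 (R0 T 2 1 1 r) (lin_ext K M (\<lambda>s. m) (Rs T 2 1 1 r)) a = \<theta>2 r m a"
    using eq[of 1 "[enc (\<zero>\<^bsub>A\<^esub>, m), enc (a, \<zero>\<^bsub>M\<^esub>)]"] r R a m L[OF R(4)]
    by (simp add: pcomp_2_1_1_apply simps del: One_nat_def)
qed

text \<open>The left unit axiom of the operad on \<open>A\<close>, evaluated at \<open>r\<close>:
  the outer identity ignores its index \<open>R0 T 1 1 2 r\<close> and returns its argument. It
  clears the structure function inside the middle term of \<open>\<delta> 1\<close>.\<close>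

lemma mul_unit:
  assumes r: "r \<in> U T 2" and a: "a \<in> carrier A" and b: "b \<in> carrier A"
  shows "lin_ext K A (\<lambda>s. mul s [a, b]) (Rs T 1 1 2 r) = mul r [a, b]"
proof -
  note R = R_closed_2[OF r]
  have "pcomp K T A 1 1 2 (pident T A) mul = mul"
    using operad[OF module_A] mul_in unfolding ns_operad_def by (metis one_le_numeral)
  then have "pident T A (R0 T 1 1 2 r) [lin_ext K A (\<lambda>s. mul s [a, b]) (Rs T 1 1 2 r)] = mul r [a, b]"
    using pcomp_1_1_2_apply[OF r a b, of K "pident T A" mul] by metis
  moreover have "lin_ext K A (\<lambda>s. mul s [a, b]) (Rs T 1 1 2 r) \<in> carrier A"
    using R a b by (auto intro!: lin_ext_in_carrier[OF module_A] simp: mul_closed)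
  ultimately show ?thesis
    using R by (simp add: pident_def nlists_1_iff)
qed

text \<open>The single index, through which a 1-cochain \<open>f\<close> becomes the linear map
  \<open>\<lambda>a. f u [a]\<close>.\<close>

definition u where "u = the_elem (U T 1)"

lemma U1_eq: "U T 1 = {u}"
  using U1 unfolding u_def by (metis card_1_singletonE the_elem_eq)

text \<open>All structure functions disappear. Over the one index \<open>u\<close> the linear
  extensions along \<open>K[U 1]\<close> are extensions of constants, which
  \<open>action_unit\<close> absorbs; \<open>mul_unit\<close> handles the middle term.\<close>

lemma coboundary_1:
  assumes f: "f \<in> carrier (C 1)"
  shows "\<delta> 1 f = cochain2 T A (\<lambda>r a b. \<theta>1 r a (f u [b]) \<oplus>\<^bsub>M\<^esub> \<ominus>\<^bsub>M\<^esub> f u [mul r [a, b]] \<oplus>\<^bsub>M\<^esub> \<theta>2 r (f u [a]) b)"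
  unfolding coboundary_def cochain2_def one_add_one
proof (intro restrict_ext)
  fix r as assume r: "r \<in> U T 2" and "as \<in> nlists 2 (carrier A)"
  then obtain a b where a: "a \<in> carrier A" and b: "b \<in> carrier A" and as: "as = [a, b]"
    by (auto simp: nlists_2_iff)
  note R = R_closed_2[OF r]
  have cl: "f u [x] \<in> carrier M" if "x \<in> carrier A" for x
    using that U1_eq by (intro hom_space_closed[OF f]) (auto simp: nlists_1_iff)
  have L: "lin_ext K M (\<lambda>s. f s [c]) x = lin_ext K M (\<lambda>s. f u [c]) x"
    if "x \<in> free_vectors K (U T 1)" "c \<in> carrier A" for x c
    using that cl U1_eq by (intro lin_ext_cong[OF module_M that(1)]) auto
  have "R0 T 1 1 2 r = u"
    using R U1_eq by simp
  then have "pcomp K T A 1 1 2 f mul r [a, b] = f u [mul r [a, b]]"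
    using r a b by (simp add: pcomp_1_1_2_apply mul_unit del: One_nat_def)
  then show "\<theta>1 (R0 T 2 2 1 r) (hd as) (lin_ext K M (\<lambda>s. f s (tl as)) (Rs T 2 2 1 r))
        \<oplus>\<^bsub>M\<^esub> (\<Oplus>\<^bsub>M\<^esub>i\<in>{1..1}. ((\<ominus>\<^bsub>K\<^esub> \<one>\<^bsub>K\<^esub>) [^]\<^bsub>K\<^esub> i) \<odot>\<^bsub>M\<^esub> pcomp K T A 1 i 2 f mul r as)
        \<oplus>\<^bsub>M\<^esub> ((\<ominus>\<^bsub>K\<^esub> \<one>\<^bsub>K\<^esub>) [^]\<^bsub>K\<^esub> (2::nat)) \<odot>\<^bsub>M\<^esub>
             \<theta>2 (R0 T 2 1 1 r) (lin_ext K M (\<lambda>s. f s (butlast as)) (Rs T 2 1 1 r)) (last as)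
      = \<theta>1 r (as ! 0) (f u [as ! 1]) \<oplus>\<^bsub>M\<^esub> \<ominus>\<^bsub>M\<^esub> f u [mul r [as ! 0, as ! 1]] \<oplus>\<^bsub>M\<^esub> \<theta>2 r (f u [as ! 0]) (as ! 1)"
    using r R a b cl
    by (simp add: as L action_unit M.sign_smult \<theta>1_closed \<theta>2_closed mul_closed M.smult_l_minus del: One_nat_def)
qed

lemma coboundary_1_apply:
  assumes "f \<in> carrier (C 1)" "r \<in> U T 2" "a \<in> carrier A" "b \<in> carrier A"
  shows "\<delta> 1 f r [a, b] = \<theta>1 r a (f u [b]) \<oplus>\<^bsub>M\<^esub> \<ominus>\<^bsub>M\<^esub> f u [mul r [a, b]] \<oplus>\<^bsub>M\<^esub> \<theta>2 r (f u [a]) b"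
  using assms by (simp add: coboundary_1 del: One_nat_def)

lemma cochain_1_linear: "f \<in> carrier (C 1) \<Longrightarrow> linear_map K A M (\<lambda>a. f u [a])"
  using hom_space_1_linear[of f K T A M u] U1_eq A.zero_closed by blast

lemma coboundary_1_closed:
  assumes f: "f \<in> carrier (C 1)"
  shows "\<delta> 1 f \<in> carrier (C 2)"
  unfolding coboundary_1[OF f]
proof (rule cochain2_in_hom_space[OF module_A])
  fix r assume r: "r \<in> U T 2"
  note h = cochain_1_linear[OF f]
  show "bilinear_map K A A M (\<lambda>a b. \<theta>1 r a (f u [b]) \<oplus>\<^bsub>M\<^esub> \<ominus>\<^bsub>M\<^esub> f u [mul r [a, b]] \<oplus>\<^bsub>M\<^esub> \<theta>2 r (f u [a]) b)"
    by (intro bilinear_map_sum[OF module_M] bilinear_map_uminus[OF module_M]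
          bilinear_map_compose[OF \<theta>1_bilinear[OF r] linear_map_id h linear_map_id]
          bilinear_map_compose[OF mul_bilinear[OF r] linear_map_id linear_map_id h]
          bilinear_map_compose[OF \<theta>2_bilinear[OF r] h linear_map_id linear_map_id])
qed

text \<open>As the image of a homomorphism, the coboundaries form a subgroup of the
  2-cochains.\<close>

lemma coboundary_1_hom: "group_hom (add_monoid (C 1)) (add_monoid (C 2)) (\<delta> 1)"
proof -
  interpret C1: abelian_group "C 1" by (rule abelian_group_C)
  interpret C2: abelian_group "C 2" by (rule abelian_group_C)
  have "\<delta> 1 (f \<oplus>\<^bsub>C 1\<^esub> g) = \<delta> 1 f \<oplus>\<^bsub>C 2\<^esub> \<delta> 1 g" if f: "f \<in> carrier (C 1)" and g: "g \<in> carrier (C 1)" for f g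
  proof (rule hom_space_2_eqI)
    show "\<delta> 1 (f \<oplus>\<^bsub>C 1\<^esub> g) \<in> carrier (C 2)" "\<delta> 1 f \<oplus>\<^bsub>C 2\<^esub> \<delta> 1 g \<in> carrier (C 2)"
      using f g by (auto intro!: coboundary_1_closed C1.a_closed C2.a_closed simp del: One_nat_def)
    fix r a b assume r: "r \<in> U T 2" and a: "a \<in> carrier A" and b: "b \<in> carrier A"
    have fg: "(f \<oplus>\<^bsub>C 1\<^esub> g) u [x] = f u [x] \<oplus>\<^bsub>M\<^esub> g u [x]" if "x \<in> carrier A" for x
      using that U1_eq by (intro hom_space_add_apply) (auto simp: nlists_1_iff)
    have cl: "f u [x] \<in> carrier M" "g u [x] \<in> carrier M" if "x \<in> carrier A" for x
      using that by (auto intro: linear_map_closed[OF cochain_1_linear[OF f]]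
          linear_map_closed[OF cochain_1_linear[OF g]])
    have "(\<delta> 1 f \<oplus>\<^bsub>C 2\<^esub> \<delta> 1 g) r [a, b] = \<delta> 1 f r [a, b] \<oplus>\<^bsub>M\<^esub> \<delta> 1 g r [a, b]"
      using r a b by (intro hom_space_add_apply) (auto simp: nlists_2_iff)
    then show "\<delta> 1 (f \<oplus>\<^bsub>C 1\<^esub> g) r [a, b] = (\<delta> 1 f \<oplus>\<^bsub>C 2\<^esub> \<delta> 1 g) r [a, b]"
      using r a b f g cl
      by (simp add: coboundary_1_apply C1.a_closed fg mul_closed \<theta>1_add \<theta>2_add \<theta>1_closed \<theta>2_closed
            M.minus_add M.a_ac del: One_nat_def)
  qed
  then show ?thesis
    using C1.a_group C2.a_group
    by (auto simp: group_hom_def group_hom_axioms_def hom_def coboundary_1_closed simp del: One_nat_def)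
qed

definition coboundaries :: "('r \<Rightarrow> 'u list \<Rightarrow> 'u) set" where
  "coboundaries = \<delta> 1 ` carrier (C 1)"

definition cocycles :: "('r \<Rightarrow> 'u list \<Rightarrow> 'u) set" where
  "cocycles = {z \<in> carrier (C 2). cocycle z}"

lemma coboundary_2_eq_zero_iff:
  assumes z: "z \<in> carrier (C 2)" and y: "y \<in> U T 3"
    and a: "a \<in> carrier A" and b: "b \<in> carrier A" and c: "c \<in> carrier A"
  shows "\<delta> 2 z y [a, b, c] = \<zero>\<^bsub>M\<^esub> \<longleftrightarrow> cocycle_at z y a b c"
proof -
  note R = R_closed_3[OF y]
  define ab where "ab = lin_ext K A (\<lambda>s. mul s [a, b]) (Rs T 2 1 2 y)"
  define bc where "bc = lin_ext K A (\<lambda>s. mul s [b, c]) (Rs T 2 2 2 y)"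
  define zab where "zab = lin_ext K M (\<lambda>s. z s [a, b]) (Rs T 2 1 2 y)"
  define zbc where "zbc = lin_ext K M (\<lambda>s. z s [b, c]) (Rs T 2 2 2 y)"
  have "ab \<in> carrier A" "bc \<in> carrier A" "zab \<in> carrier M" "zbc \<in> carrier M"
    unfolding ab_def bc_def zab_def zbc_def using R a b c
    by (auto intro!: lin_ext_in_carrier[OF module_A] lin_ext_in_carrier[OF module_M]
          simp: mul_closed hom_space_2_closed[OF z])
  then have cl: "z (R0 T 2 1 2 y) [ab, c] \<in> carrier M" "z (R0 T 2 2 2 y) [a, bc] \<in> carrier M"
    "\<theta>1 (R0 T 2 2 2 y) a zbc \<in> carrier M" "\<theta>2 (R0 T 2 1 2 y) zab c \<in> carrier M"
    using R a c by (auto intro: hom_space_2_closed[OF z] \<theta>1_closed \<theta>2_closed)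
  \<comment> \<open>Here \<open>p\<close>, \<open>q\<close>, \<open>v\<close>, \<open>w\<close>
    stand for the four terms of \<open>\<delta> 2 z\<close> in their order; the two negative ones
    change sides.\<close>
  have iff: "p \<oplus>\<^bsub>M\<^esub> (\<ominus>\<^bsub>M\<^esub> q \<oplus>\<^bsub>M\<^esub> v) \<oplus>\<^bsub>M\<^esub> \<ominus>\<^bsub>M\<^esub> w = \<zero>\<^bsub>M\<^esub> \<longleftrightarrow> w \<oplus>\<^bsub>M\<^esub> q = p \<oplus>\<^bsub>M\<^esub> v"
    if "p \<in> carrier M" "q \<in> carrier M" "v \<in> carrier M" "w \<in> carrier M" for p q v w
  proof -
    have "p \<oplus>\<^bsub>M\<^esub> (\<ominus>\<^bsub>M\<^esub> q \<oplus>\<^bsub>M\<^esub> v) \<oplus>\<^bsub>M\<^esub> \<ominus>\<^bsub>M\<^esub> w = (p \<oplus>\<^bsub>M\<^esub> v) \<ominus>\<^bsub>M\<^esub> (w \<oplus>\<^bsub>M\<^esub> q)"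
      using that by (simp add: M.minus_eq M.minus_add M.a_ac)
    then show ?thesis
      using that M.minus_equality[of "p \<oplus>\<^bsub>M\<^esub> v" "\<ominus>\<^bsub>M\<^esub> (w \<oplus>\<^bsub>M\<^esub> q)"] M.r_neg[of "w \<oplus>\<^bsub>M\<^esub> q"]
      by (auto simp: M.minus_eq)
  qed
  have "{1..2::nat} = {1, 2}" by auto
  moreover have "pcomp K T A 2 1 2 z mul y [a, b, c] = z (R0 T 2 1 2 y) [ab, c]"
    "pcomp K T A 2 2 2 z mul y [a, b, c] = z (R0 T 2 2 2 y) [a, bc]"
    unfolding ab_def bc_def by (rule pcomp_2_1_2_apply[OF y a b c], rule pcomp_2_2_2_apply[OF y a b c])
  ultimately have "\<delta> 2 z y [a, b, c] = \<theta>1 (R0 T 2 2 2 y) a zbc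
      \<oplus>\<^bsub>M\<^esub> (\<ominus>\<^bsub>M\<^esub> z (R0 T 2 1 2 y) [ab, c] \<oplus>\<^bsub>M\<^esub> z (R0 T 2 2 2 y) [a, bc])
      \<oplus>\<^bsub>M\<^esub> \<ominus>\<^bsub>M\<^esub> \<theta>2 (R0 T 2 1 2 y) zab c"
    using y a b c cl
    by (simp add: coboundary_def nlists_3_iff zab_def[symmetric] zbc_def[symmetric] M.sign_smult M.smult_l_minus
          del: One_nat_def)
  then show ?thesis
    using iff[OF cl(3,1,2,4)]
    by (simp add: cocycle_at_def ab_def bc_def zab_def zbc_def del: One_nat_def)
qed

lemma kernel_coboundary_2: "a_kernel (C 2) (C (2 + 1)) (\<delta> 2) = cocycles"
proof -
  have "\<delta> 2 z = \<zero>\<^bsub>C (2 + 1)\<^esub> \<longleftrightarrow> cocycle z" if "z \<in> carrier (C 2)" for z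
  proof -
    have "\<delta> 2 z = \<zero>\<^bsub>C 3\<^esub> \<longleftrightarrow> (\<forall>y\<in>U T 3. \<forall>a\<in>carrier A. \<forall>b\<in>carrier A. \<forall>c\<in>carrier A.
        \<delta> 2 z y [a, b, c] = \<zero>\<^bsub>M\<^esub>)"
      unfolding coboundary_def hom_space_def
      by (simp add: restrict_eq_iff ball_nlists_3 nlists_3_iff)
    then show ?thesis
      using that by (simp add: coboundary_2_eq_zero_iff cocycle_def)
  qed
  then show ?thesis
    by (auto simp: a_kernel_def' cocycles_def)
qed

text \<open>Replacing the carrier by the cocycles leaves the addition of \<open>C 2\<close> in
  place, so the cosets are those formed in \<open>C 2\<close>.\<close>

lemma carrier_cohomology_2:
  "carrier (cohomology K T A mul M \<theta>1 \<theta>2 2) = (\<lambda>z. coboundaries +>\<^bsub>C 2\<^esub> z) ` cocycles"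
  unfolding cohomology_def Let_def kernel_coboundary_2
  by (auto simp: A_FactGroup_def FactGroup_def RCOSETS_def a_r_coset_def r_coset_def coboundaries_def)

text \<open>The equation \<open>z - z' = \<delta> h\<close> without minus signs. The same equation
  expresses that the shear along \<open>h\<close> is multiplicative, which makes it the meeting
  point of cohomology and extensions.\<close>

definition cohomologous_via ::
  "('r \<Rightarrow> 'u list \<Rightarrow> 'u) \<Rightarrow> ('r \<Rightarrow> 'u list \<Rightarrow> 'u) \<Rightarrow> ('u \<Rightarrow> 'u) \<Rightarrow> bool" where
  "cohomologous_via z z' h \<longleftrightarrow> linear_map K A M h \<and>
     (\<forall>r\<in>U T 2. \<forall>a\<in>carrier A. \<forall>b\<in>carrier A.
        h (mul r [a, b]) \<oplus>\<^bsub>M\<^esub> z r [a, b] = \<theta>1 r a (h b) \<oplus>\<^bsub>M\<^esub> \<theta>2 r (h a) b \<oplus>\<^bsub>M\<^esub> z' r [a, b])"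

lemma eq_coboundary_add_iff:
  assumes f: "f \<in> carrier (C 1)" and z: "z \<in> carrier (C 2)" and z': "z' \<in> carrier (C 2)"
  shows "z = \<delta> 1 f \<oplus>\<^bsub>C 2\<^esub> z' \<longleftrightarrow> cohomologous_via z z' (\<lambda>a. f u [a])"
proof -
  interpret C2: abelian_group "C 2" by (rule abelian_group_C)
  have h: "linear_map K A M (\<lambda>a. f u [a])"
    by (rule cochain_1_linear[OF f])
  have cl: "f u [x] \<in> carrier M" if "x \<in> carrier A" for x
    using that by (rule linear_map_closed[OF h])
  have iff: "v = p \<oplus>\<^bsub>M\<^esub> \<ominus>\<^bsub>M\<^esub> k \<oplus>\<^bsub>M\<^esub> q \<oplus>\<^bsub>M\<^esub> w \<longleftrightarrow> k \<oplus>\<^bsub>M\<^esub> v = p \<oplus>\<^bsub>M\<^esub> q \<oplus>\<^bsub>M\<^esub> w"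
    if "p \<in> carrier M" "q \<in> carrier M" "v \<in> carrier M" "w \<in> carrier M" "k \<in> carrier M" for p q v w k
  proof -
    have "p \<oplus>\<^bsub>M\<^esub> \<ominus>\<^bsub>M\<^esub> k \<oplus>\<^bsub>M\<^esub> q \<oplus>\<^bsub>M\<^esub> w = \<ominus>\<^bsub>M\<^esub> k \<oplus>\<^bsub>M\<^esub> (p \<oplus>\<^bsub>M\<^esub> q \<oplus>\<^bsub>M\<^esub> w)"
      using that by (simp add: M.a_ac)
    then show ?thesis
      using that by (metis M.add.m_closed M.a_inv_closed M.r_neg1 M.r_neg2)
  qed
  have "z = \<delta> 1 f \<oplus>\<^bsub>C 2\<^esub> z' \<longleftrightarrow> (\<forall>r\<in>U T 2. \<forall>a\<in>carrier A. \<forall>b\<in>carrier A.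
      z r [a, b] = (\<delta> 1 f \<oplus>\<^bsub>C 2\<^esub> z') r [a, b])"
    using hom_space_2_eqI[OF z C2.a_closed[OF coboundary_1_closed[OF f] z']] by auto
  also have "\<dots> \<longleftrightarrow> (\<forall>r\<in>U T 2. \<forall>a\<in>carrier A. \<forall>b\<in>carrier A.
      z r [a, b] = \<theta>1 r a (f u [b]) \<oplus>\<^bsub>M\<^esub> \<ominus>\<^bsub>M\<^esub> f u [mul r [a, b]] \<oplus>\<^bsub>M\<^esub> \<theta>2 r (f u [a]) b \<oplus>\<^bsub>M\<^esub> z' r [a, b])"
    using f by (simp add: hom_space_add_apply nlists_2_iff coboundary_1_apply del: One_nat_def cong: ball_cong)
  also have "\<dots> \<longleftrightarrow> cohomologous_via z z' (\<lambda>a. f u [a])"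
    using h z z' cl
    by (simp add: cohomologous_via_def iff \<theta>1_closed \<theta>2_closed mul_closed hom_space_2_closed cong: ball_cong)
  finally show ?thesis .
qed

text \<open>Since the coboundaries form a subgroup, two cosets agree iff \<open>z\<close> lies in
  the coset of \<open>z'\<close>. Because there is one index at arity 1, a 1-cochain and a linear
  map \<open>h\<close> are the same data.\<close>

lemma coset_eq_iff:
  assumes z: "z \<in> carrier (C 2)" and z': "z' \<in> carrier (C 2)"
  shows "coboundaries +>\<^bsub>C 2\<^esub> z = coboundaries +>\<^bsub>C 2\<^esub> z' \<longleftrightarrow> (\<exists>h. cohomologous_via z z' h)"
proof -
  interpret C2: abelian_group "C 2" by (rule abelian_group_C)
  have B: "subgroup coboundaries (add_monoid (C 2))"
    using group_hom.img_is_subgroup[OF coboundary_1_hom] by (simp add: coboundaries_def)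
  have "coboundaries +>\<^bsub>C 2\<^esub> z = coboundaries +>\<^bsub>C 2\<^esub> z' \<longleftrightarrow> z \<in> coboundaries +>\<^bsub>C 2\<^esub> z'"
    using group.repr_independence[OF C2.a_group _ _ B, of z z'] group.rcos_self[OF C2.a_group _ B, of z] z z'
    by (auto simp: a_r_coset_def)
  also have "\<dots> \<longleftrightarrow> (\<exists>f\<in>carrier (C 1). z = \<delta> 1 f \<oplus>\<^bsub>C 2\<^esub> z')"
    by (auto simp: a_r_coset_def' coboundaries_def)
  also have "\<dots> \<longleftrightarrow> (\<exists>f\<in>carrier (C 1). cohomologous_via z z' (\<lambda>a. f u [a]))"
    using z z' by (simp add: eq_coboundary_add_iff del: One_nat_def cong: bex_cong)
  also have "\<dots> \<longleftrightarrow> (\<exists>h. cohomologous_via z z' h)"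
  proof
    assume "\<exists>h. cohomologous_via z z' h"
    then obtain h where h: "cohomologous_via z z' h" by blast
    then have hl: "linear_map K A M h"
      by (simp add: cohomologous_via_def)
    let ?f = "cochain1 T A h"
    have f: "?f \<in> carrier (C 1)"
      by (rule cochain1_in_hom_space[OF module_A hl])
    have "?f u [a] = h a" if "a \<in> carrier A" for a
      using that U1_eq by (simp del: One_nat_def)
    then have "cohomologous_via z z' (\<lambda>a. ?f u [a])"
      using h cochain_1_linear[OF f] by (simp add: cohomologous_via_def mul_closed)
    then show "\<exists>f\<in>carrier (C 1). cohomologous_via z z' (\<lambda>a. f u [a])"
      using f by blast
  qed blast
  finally show ?thesis .
qed

end

section \<open>Abelian extensions\<close>

lemma equivalent_extensionsI:
  assumes "linear_map K (ext_space P) (ext_space Q) \<phi>"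
    and "\<And>r x y. \<lbrakk>r \<in> U T 2; x \<in> carrier (ext_space P); y \<in> carrier (ext_space P)\<rbrakk>
           \<Longrightarrow> \<phi> (ext_mult P r [x, y]) = ext_mult Q r [\<phi> x, \<phi> y]"
    and "\<And>m. m \<in> carrier M \<Longrightarrow> \<phi> (ext_incl P m) = ext_incl Q m"
    and "\<And>e. e \<in> carrier (ext_space P) \<Longrightarrow> ext_proj Q (\<phi> e) = ext_proj P e"
  shows "equivalent_extensions K T M P Q"
  unfolding equivalent_extensions_def loday_morphism_def using assms by blast

lemma equivalent_extensionsE:
  assumes "equivalent_extensions K T M P Q"
  obtains \<phi> where "linear_map K (ext_space P) (ext_space Q) \<phi>"
    and "\<And>r x y. \<lbrakk>r \<in> U T 2; x \<in> carrier (ext_space P); y \<in> carrier (ext_space P)\<rbrakk>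
           \<Longrightarrow> \<phi> (ext_mult P r [x, y]) = ext_mult Q r [\<phi> x, \<phi> y]"
    and "\<And>m. m \<in> carrier M \<Longrightarrow> \<phi> (ext_incl P m) = ext_incl Q m"
    and "\<And>e. e \<in> carrier (ext_space P) \<Longrightarrow> ext_proj Q (\<phi> e) = ext_proj P e"
  using assms unfolding equivalent_extensions_def loday_morphism_def by blast

text \<open>Equivalence of extensions asks for a morphism in one direction only; bijectivity of that
  morphism is what makes the relation symmetric.\<close>

lemma short_five_lemma:
  assumes V: "module K V" and W: "module K W" and A: "module K A" and M: "module K M"
    and \<phi>: "linear_map K V W \<phi>"
    and i: "linear_map K M V i" "i ` carrier M = a_kernel V A j"
    and j: "linear_map K V A j" "j ` carrier V = carrier A"
    and i': "linear_map K M W i'" "inj_on i' (carrier M)" "i' ` carrier M = a_kernel W A j'"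
    and j': "linear_map K W A j'"
    and \<phi>i: "\<And>m. m \<in> carrier M \<Longrightarrow> \<phi> (i m) = i' m"
    and j\<phi>: "\<And>e. e \<in> carrier V \<Longrightarrow> j' (\<phi> e) = j e"
  shows "bij_betw \<phi> (carrier V) (carrier W)"
proof -
  interpret V: module K V by fact
  interpret W: module K W by fact
  interpret A: module K A by fact
  interpret M: module K M by fact
  interpret \<phi>: abelian_group_hom V W \<phi>
    by (rule abelian_group_hom_linear_map[OF V W \<phi>])
  have "inj_on \<phi> (carrier V)"
  proof (rule inj_onI)
    fix x y assume x: "x \<in> carrier V" and y: "y \<in> carrier V" and eq: "\<phi> x = \<phi> y"
    \<comment> \<open>The difference lies over zero in \<open>A\<close>, so it comes from
      \<open>M\<close>, where injectivity of \<open>i'\<close> forces it to vanish.\<close>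
    have \<phi>0: "\<phi> (x \<ominus>\<^bsub>V\<^esub> y) = \<zero>\<^bsub>W\<^esub>"
      using x y eq by (simp add: V.minus_eq W.r_neg)
    have "j (x \<ominus>\<^bsub>V\<^esub> y) = \<zero>\<^bsub>A\<^esub>"
      using j\<phi>[of "x \<ominus>\<^bsub>V\<^esub> y"] x y \<phi>0 linear_map_zero[OF W A j'] by simp
    then have "x \<ominus>\<^bsub>V\<^esub> y \<in> i ` carrier M"
      using x y by (simp add: i(2) a_kernel_def')
    then obtain m where m: "m \<in> carrier M" "x \<ominus>\<^bsub>V\<^esub> y = i m"
      by blast
    then have "i' m = i' \<zero>\<^bsub>M\<^esub>"
      using \<phi>0 \<phi>i[of m] linear_map_zero[OF M W i'(1)] by simp
    then have "m = \<zero>\<^bsub>M\<^esub>"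
      using i'(2) m by (simp add: inj_on_eq_iff)
    then have "x \<ominus>\<^bsub>V\<^esub> y = \<zero>\<^bsub>V\<^esub>"
      using m linear_map_zero[OF M V i(1)] by simp
    then show "x = y"
      using x y V.minus_equality[of x "\<ominus>\<^bsub>V\<^esub> y"] by (simp add: V.minus_eq)
  qed
  moreover have "\<phi> ` carrier V = carrier W"
  proof (intro equalityI subsetI)
    fix w assume w: "w \<in> carrier W"
    \<comment> \<open>Choose \<open>v\<close> over the same point of \<open>A\<close> as
      \<open>w\<close>. The error \<open>w - \<phi> v\<close> lies in the kernel of
      \<open>j'\<close>, hence comes from \<open>M\<close>, and \<open>i m\<close> corrects
      \<open>v\<close>.\<close>
    then obtain v where v: "v \<in> carrier V" "j' w = j v"
      using j(2) linear_map_closed[OF j'] by blast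
    have "j' (w \<ominus>\<^bsub>W\<^esub> \<phi> v) = \<zero>\<^bsub>A\<^esub>"
      using w v linear_map_closed[OF j(1)]
      by (simp add: W.minus_eq linear_map_add[OF j'] linear_map_minus[OF W A j'] j\<phi> A.r_neg)
    moreover have "w \<ominus>\<^bsub>W\<^esub> \<phi> v \<in> carrier W"
      using w v(1) by simp
    ultimately have "w \<ominus>\<^bsub>W\<^esub> \<phi> v \<in> i' ` carrier M"
      unfolding i'(3) a_kernel_def' by blast
    then obtain m where m: "m \<in> carrier M" "w \<ominus>\<^bsub>W\<^esub> \<phi> v = i' m"
      by blast
    have im: "i m \<in> carrier V"
      using m linear_map_closed[OF i(1)] by simp
    have "\<phi> (v \<oplus>\<^bsub>V\<^esub> i m) = \<phi> v \<oplus>\<^bsub>W\<^esub> (w \<ominus>\<^bsub>W\<^esub> \<phi> v)"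
      using v m im by (simp add: \<phi>i)
    also have "\<dots> = w"
      using v w by (simp add: W.minus_eq W.a_comm[of w] W.r_neg2)
    finally show "w \<in> \<phi> ` carrier V"
      using v im by (metis V.a_closed image_eqI)
  qed auto
  ultimately show ?thesis
    by (simp add: bij_betw_def)
qed

text \<open>An injective linear map reflects linearity. This is needed for the cochain of an
  extension, whose values are obtained by inverting the inclusion of \<open>M\<close>
  pointwise.\<close>

lemma linear_map_lift:
  assumes V: "module K V" and M: "module K M" and i: "linear_map K M W i" "inj_on i (carrier M)"
    and f: "\<And>x. x \<in> carrier V \<Longrightarrow> f x \<in> carrier M" and fi: "linear_map K V W (\<lambda>x. i (f x))"
  shows "linear_map K V M f"
proof -
  interpret V: module K V by fact
  interpret M: module K M by fact
  show ?thesis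
  proof (rule linear_mapI)
    fix x y assume xy: "x \<in> carrier V" "y \<in> carrier V"
    then have "i (f (x \<oplus>\<^bsub>V\<^esub> y)) = i (f x \<oplus>\<^bsub>M\<^esub> f y)"
      using linear_map_add[OF fi] linear_map_add[OF i(1)] f by simp
    then show "f (x \<oplus>\<^bsub>V\<^esub> y) = f x \<oplus>\<^bsub>M\<^esub> f y"
      using i(2) xy f by (simp add: inj_on_eq_iff)
  next
    fix c x assume cx: "c \<in> carrier K" "x \<in> carrier V"
    then have "i (f (c \<odot>\<^bsub>V\<^esub> x)) = i (c \<odot>\<^bsub>M\<^esub> f x)"
      using linear_map_smult[OF fi] linear_map_smult[OF i(1)] f by simp
    then show "f (c \<odot>\<^bsub>V\<^esub> x) = c \<odot>\<^bsub>M\<^esub> f x"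
      using i(2) cx f by (simp add: inj_on_eq_iff)
  qed (rule f)
qed

context loday_module
begin

lemma abelian_extensionD:
  assumes "abelian_extension K T A mul M P"
  shows "module K (ext_space P)" "ext_mult P \<in> carrier (hom_space K T 2 (ext_space P) (ext_space P))"
    "pcomp K T (ext_space P) 2 1 2 (ext_mult P) (ext_mult P)
       = pcomp K T (ext_space P) 2 2 2 (ext_mult P) (ext_mult P)"
    "linear_map K M (ext_space P) (ext_incl P)" "linear_map K (ext_space P) A (ext_proj P)"
    "inj_on (ext_incl P) (carrier M)" "ext_incl P ` carrier M = a_kernel (ext_space P) A (ext_proj P)"
    "ext_proj P ` carrier (ext_space P) = carrier A"
    "\<exists>s. linear_section K (ext_space P) A (ext_proj P) s"
  using assms
  by (simp_all add: abelian_extension_def loday_algebra_def operad_multiplication_def loday_morphism_def)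

text \<open>The inclusion is a morphism from \<open>M\<close> with the zero multiplication.\<close>

lemma ext_mult_incl_incl:
  assumes "abelian_extension K T A mul M P" "r \<in> U T 2" "m \<in> carrier M" "n \<in> carrier M"
  shows "ext_mult P r [ext_incl P m, ext_incl P n] = \<zero>\<^bsub>ext_space P\<^esub>"
proof -
  have "ext_incl P (\<zero>\<^bsub>hom_space K T 2 M M\<^esub> r [m, n]) = ext_mult P r [ext_incl P m, ext_incl P n]"
    using assms unfolding abelian_extension_def loday_morphism_def by blast
  then have "ext_incl P \<zero>\<^bsub>M\<^esub> = ext_mult P r [ext_incl P m, ext_incl P n]"
    using assms(2-4) by (simp add: hom_space_zero_apply nlists_2_iff)
  then show ?thesis
    using linear_map_zero[OF module_M abelian_extensionD(1,4)[OF assms(1)]] by simp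
qed

lemma ext_proj_mult:
  assumes "abelian_extension K T A mul M P" "r \<in> U T 2" "x \<in> carrier (ext_space P)" "y \<in> carrier (ext_space P)"
  shows "ext_proj P (ext_mult P r [x, y]) = mul r [ext_proj P x, ext_proj P y]"
  using assms by (simp add: abelian_extension_def loday_morphism_def)

lemma ext_proj_incl:
  assumes "abelian_extension K T A mul M P" "m \<in> carrier M"
  shows "ext_proj P (ext_incl P m) = \<zero>\<^bsub>A\<^esub>"
  using abelian_extensionD(7)[OF assms(1)] assms(2) by (auto simp: a_kernel_def')

definition extensions :: "('k, 'r, 'u) extension set" where
  "extensions = {P. abelian_extension K T A mul M P \<and> induces_representation K T A M \<theta>1 \<theta>2 P}"

definition equivalence :: "(('k, 'r, 'u) extension \<times> ('k, 'r, 'u) extension) set" where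
  "equivalence = {(P, Q). P \<in> extensions \<and> Q \<in> extensions \<and> equivalent_extensions K T M P Q}"

lemma Ext_eq: "Ext K T A mul M \<theta>1 \<theta>2 = extensions // equivalence"
  by (simp add: Ext_def Let_def extensions_def equivalence_def)

text \<open>The morphism is bijective by the short five lemma, and its inverse inherits linearity,
  multiplicativity and both triangles.\<close>

lemma equivalent_extensions_sym:
  assumes P: "abelian_extension K T A mul M P" and Q: "abelian_extension K T A mul M Q"
    and eq: "equivalent_extensions K T M P Q"
  shows "equivalent_extensions K T M Q P"
proof -
  note p = abelian_extensionD[OF P] and q = abelian_extensionD[OF Q]
  obtain \<phi> where lin: "linear_map K (ext_space P) (ext_space Q) \<phi>"
    and mu: "\<And>r x y. \<lbrakk>r \<in> U T 2; x \<in> carrier (ext_space P); y \<in> carrier (ext_space P)\<rbrakk>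
           \<Longrightarrow> \<phi> (ext_mult P r [x, y]) = ext_mult Q r [\<phi> x, \<phi> y]"
    and \<phi>i: "\<And>m. m \<in> carrier M \<Longrightarrow> \<phi> (ext_incl P m) = ext_incl Q m"
    and j\<phi>: "\<And>e. e \<in> carrier (ext_space P) \<Longrightarrow> ext_proj Q (\<phi> e) = ext_proj P e"
    using eq by (rule equivalent_extensionsE) blast
  have bij: "bij_betw \<phi> (carrier (ext_space P)) (carrier (ext_space Q))"
    by (rule short_five_lemma[OF p(1) q(1) module_A module_M lin p(4,7,5,8) q(4,6,7,5) \<phi>i j\<phi>])
  let ?\<psi> = "inv_into (carrier (ext_space P)) \<phi>"
  have \<psi>: "?\<psi> y \<in> carrier (ext_space P)" "\<phi> (?\<psi> y) = y" if "y \<in> carrier (ext_space Q)" for y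
    using that bij by (auto simp: bij_betw_def inv_into_into f_inv_into_f)
  have \<psi>I: "?\<psi> (\<phi> x) = x" if "x \<in> carrier (ext_space P)" for x
    using that bij by (auto simp: bij_betw_def)
  show ?thesis
  proof (rule equivalent_extensionsI)
    show "linear_map K (ext_space Q) (ext_space P) ?\<psi>"
      by (rule linear_map_inv_into[OF p(1) lin bij])
  next
    fix r x y assume h: "r \<in> U T 2" "x \<in> carrier (ext_space Q)" "y \<in> carrier (ext_space Q)"
    then have "ext_mult Q r [x, y] = \<phi> (ext_mult P r [?\<psi> x, ?\<psi> y])"
      by (simp add: mu \<psi>)
    then show "?\<psi> (ext_mult Q r [x, y]) = ext_mult P r [?\<psi> x, ?\<psi> y]"
      using h by (simp add: \<psi>I \<psi> hom_space_2_closed[OF p(2)])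
  next
    fix m assume "m \<in> carrier M"
    then show "?\<psi> (ext_incl Q m) = ext_incl P m"
      using \<psi>I[of "ext_incl P m"] \<phi>i[of m] linear_map_closed[OF p(4), of m] by simp
  next
    fix e assume "e \<in> carrier (ext_space Q)"
    then show "ext_proj P (?\<psi> e) = ext_proj Q e"
      using j\<phi>[of "?\<psi> e"] \<psi>[of e] by simp
  qed
qed

lemma equivalent_extensions_trans:
  assumes "equivalent_extensions K T M P Q" "equivalent_extensions K T M Q S"
  shows "equivalent_extensions K T M P S"
proof -
  obtain \<phi> where \<phi>: "linear_map K (ext_space P) (ext_space Q) \<phi>"
    "\<And>r x y. \<lbrakk>r \<in> U T 2; x \<in> carrier (ext_space P); y \<in> carrier (ext_space P)\<rbrakk>
       \<Longrightarrow> \<phi> (ext_mult P r [x, y]) = ext_mult Q r [\<phi> x, \<phi> y]"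
    "\<And>m. m \<in> carrier M \<Longrightarrow> \<phi> (ext_incl P m) = ext_incl Q m"
    "\<And>e. e \<in> carrier (ext_space P) \<Longrightarrow> ext_proj Q (\<phi> e) = ext_proj P e"
    using assms(1) by (rule equivalent_extensionsE) blast
  obtain \<psi> where \<psi>: "linear_map K (ext_space Q) (ext_space S) \<psi>"
    "\<And>r x y. \<lbrakk>r \<in> U T 2; x \<in> carrier (ext_space Q); y \<in> carrier (ext_space Q)\<rbrakk>
       \<Longrightarrow> \<psi> (ext_mult Q r [x, y]) = ext_mult S r [\<psi> x, \<psi> y]"
    "\<And>m. m \<in> carrier M \<Longrightarrow> \<psi> (ext_incl Q m) = ext_incl S m"
    "\<And>e. e \<in> carrier (ext_space Q) \<Longrightarrow> ext_proj S (\<psi> e) = ext_proj Q e"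
    using assms(2) by (rule equivalent_extensionsE) blast
  show ?thesis
    by (rule equivalent_extensionsI[OF linear_map_comp[OF \<phi>(1) \<psi>(1)]])
       (simp_all add: \<phi> \<psi> linear_map_closed[OF \<phi>(1)])
qed

lemma equiv_equivalence: "equiv extensions equivalence"
proof (rule equivI)
  show "equivalence \<subseteq> extensions \<times> extensions"
    by (auto simp: equivalence_def)
  have "equivalent_extensions K T M P P" for P
    by (intro equivalent_extensionsI[OF linear_map_id]) auto
  then show "refl_on extensions equivalence"
    by (auto simp: refl_on_def equivalence_def)
  show "sym equivalence"
    using equivalent_extensions_sym by (auto simp: sym_def equivalence_def extensions_def)
  show "trans equivalence"
    using equivalent_extensions_trans unfolding trans_def equivalence_def by blast
qed

section \<open>Extensions from cocycles and cocycles from extensions\<close>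

definition ext_of :: "('r \<Rightarrow> 'u list \<Rightarrow> 'u) \<Rightarrow> ('k, 'r, 'u) extension" where
  "ext_of z = \<lparr> ext_space = E, ext_mult = tmul z, ext_incl = (\<lambda>m. enc (\<zero>\<^bsub>A\<^esub>, m)), ext_proj = pA \<rparr>"

lemma ext_of_simps [simp]:
  "ext_space (ext_of z) = E" "ext_mult (ext_of z) = tmul z"
  "ext_incl (ext_of z) = (\<lambda>m. enc (\<zero>\<^bsub>A\<^esub>, m))" "ext_proj (ext_of z) = pA"
  by (simp_all add: ext_of_def)

lemma ext_of_in_extensions:
  assumes "z \<in> cocycles"
  shows "ext_of z \<in> extensions"
proof -
  have z: "z \<in> carrier (C 2)" and "cocycle z"
    using assms by (auto simp: cocycles_def)
  then have assoc: "pcomp K T E 2 1 2 (tmul z) (tmul z) = pcomp K T E 2 2 2 (tmul z) (tmul z)"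
    by (simp add: tmul_assoc_iff del: One_nat_def)
  note simps = tmul_enc \<theta>1_zero \<theta>2_zero \<theta>1_closed \<theta>2_closed mul_closed mul_zero cochain_zero[OF z]
    hom_space_2_closed[OF z]
  have "abelian_extension K T A mul M (ext_of z)"
    unfolding abelian_extension_def ext_of_simps
  proof (intro conjI)
    show "loday_algebra K T E (tmul z)"
      using module_E tmul_in[OF z] assoc
      by (simp add: loday_algebra_def operad_multiplication_def del: One_nat_def)
    show "loday_morphism K T M \<zero>\<^bsub>hom_space K T 2 M M\<^esub> E (tmul z) (\<lambda>m. enc (\<zero>\<^bsub>A\<^esub>, m))"
      using linear_enc[where V = M, OF linear_map_zero_map[OF module_A] linear_map_id]
      by (simp add: loday_morphism_def hom_space_zero_apply nlists_2_iff simps)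
    show "loday_morphism K T E (tmul z) A mul pA"
      using linear_pA by (auto simp: loday_morphism_def simps elim!: enc_cases)
    show "inj_on (\<lambda>m. enc (\<zero>\<^bsub>A\<^esub>, m)) (carrier M)"
      by (auto simp: inj_on_def enc_eq_iff)
    show "(\<lambda>m. enc (\<zero>\<^bsub>A\<^esub>, m)) ` carrier M = a_kernel E A pA"
      by (auto simp: a_kernel_def' elim!: enc_cases)
    show "pA ` carrier E = carrier A"
    proof (intro equalityI subsetI)
      fix a assume "a \<in> carrier A"
      then show "a \<in> pA ` carrier E"
        by (intro image_eqI[of a pA "enc (a, \<zero>\<^bsub>M\<^esub>)"]) simp_all
    qed auto
    have "linear_section K E A pA (\<lambda>a. enc (a, \<zero>\<^bsub>M\<^esub>))"
      using linear_enc[OF linear_map_id linear_map_zero_map[OF module_M]]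
      by (simp add: linear_section_def)
    then show "\<exists>s. linear_section K E A pA s" by blast
  qed
  moreover have "induces_representation K T A M \<theta>1 \<theta>2 (ext_of z)"
    unfolding induces_representation_def ext_of_simps
  proof (intro allI impI ballI)
    fix s r a m
    assume s: "linear_section K E A pA s" and r: "r \<in> U T 2" and a: "a \<in> carrier A" and m: "m \<in> carrier M"
    have "s a \<in> carrier E" "pA (s a) = a"
      using s a linear_map_closed by (auto simp: linear_section_def)
    \<comment> \<open>The condition ranges over all sections, so \<open>s a\<close> carries an
      arbitrary \<open>M\<close> component \<open>t\<close>. It only meets the zero of
      \<open>A\<close> in the second factor, and therefore drops out.\<close>
    then obtain t where "t \<in> carrier M" "s a = enc (a, t)"
      by (metis enc_pA_pM pM_closed)
    then show "enc (\<zero>\<^bsub>A\<^esub>, \<theta>1 r a m) = tmul z r [s a, enc (\<zero>\<^bsub>A\<^esub>, m)] \<and>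
      enc (\<zero>\<^bsub>A\<^esub>, \<theta>2 r m a) = tmul z r [enc (\<zero>\<^bsub>A\<^esub>, m), s a]"
      using r a m by (simp add: simps)
  qed
  ultimately show ?thesis
    by (simp add: extensions_def)
qed

text \<open>
  An equivalence is a shear \<open>(a, m) \<mapsto> (a, h a + m)\<close>, and it is multiplicative iff \<open>h\<close> is a
  1-cochain with coboundary \<open>z - z'\<close>.
\<close>

lemma equivalent_ext_of_iff:
  assumes z: "z \<in> carrier (C 2)" and z': "z' \<in> carrier (C 2)"
  shows "equivalent_extensions K T M (ext_of z) (ext_of z') \<longleftrightarrow> (\<exists>h. cohomologous_via z z' h)"
proof
  assume "equivalent_extensions K T M (ext_of z) (ext_of z')"
  then obtain \<phi> where lin: "linear_map K E E \<phi>"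
    and mu: "\<And>r x y. \<lbrakk>r \<in> U T 2; x \<in> carrier E; y \<in> carrier E\<rbrakk> \<Longrightarrow> \<phi> (tmul z r [x, y]) = tmul z' r [\<phi> x, \<phi> y]"
    and \<phi>i: "\<And>m. m \<in> carrier M \<Longrightarrow> \<phi> (enc (\<zero>\<^bsub>A\<^esub>, m)) = enc (\<zero>\<^bsub>A\<^esub>, m)"
    and j\<phi>: "\<And>e. e \<in> carrier E \<Longrightarrow> pA (\<phi> e) = pA e"
    by (rule equivalent_extensionsE[of K T M "ext_of z" "ext_of z'"]) auto
  define h where "h a = pM (\<phi> (enc (a, \<zero>\<^bsub>M\<^esub>)))" for a
  have hl: "linear_map K A M h"
    unfolding h_def
    by (rule linear_map_comp[OF linear_map_comp[OF
          linear_enc[OF linear_map_id linear_map_zero_map[OF module_M]] lin] linear_pM])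
  note hc = linear_map_closed[OF hl]
  \<comment> \<open>The triangles say that \<open>\<phi>\<close> keeps the \<open>A\<close>
    component and fixes the copy of \<open>M\<close>; additivity on
    \<open>(a, m) = (a, 0) + (0, m)\<close> leaves only a shear.\<close>
  have \<phi>: "\<phi> (enc (a, m)) = enc (a, h a \<oplus>\<^bsub>M\<^esub> m)" if "a \<in> carrier A" "m \<in> carrier M" for a m
  proof -
    have "\<phi> (enc (a, \<zero>\<^bsub>M\<^esub>)) = enc (a, h a)"
      using that j\<phi>[of "enc (a, \<zero>\<^bsub>M\<^esub>)"] enc_pA_pM[OF linear_map_closed[OF lin], of "enc (a, \<zero>\<^bsub>M\<^esub>)"]
      by (simp add: h_def)
    moreover have "enc (a, m) = enc (a, \<zero>\<^bsub>M\<^esub>) \<oplus>\<^bsub>E\<^esub> enc (\<zero>\<^bsub>A\<^esub>, m)"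
      using that by (simp add: add_E)
    ultimately show ?thesis
      using that hc by (simp add: linear_map_add[OF lin] \<phi>i) (simp add: add_E)
  qed
  have "h (mul r [a, b]) \<oplus>\<^bsub>M\<^esub> z r [a, b] = \<theta>1 r a (h b) \<oplus>\<^bsub>M\<^esub> \<theta>2 r (h a) b \<oplus>\<^bsub>M\<^esub> z' r [a, b]"
    if "r \<in> U T 2" "a \<in> carrier A" "b \<in> carrier A" for r a b
    using that mu[of r "enc (a, \<zero>\<^bsub>M\<^esub>)" "enc (b, \<zero>\<^bsub>M\<^esub>)"] hc
    by (simp add: \<phi> tmul_enc \<theta>1_zero \<theta>2_zero \<theta>1_closed \<theta>2_closed mul_closed enc_eq_iff
          hom_space_2_closed[OF z] hom_space_2_closed[OF z'])
  then show "\<exists>h. cohomologous_via z z' h"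
    using hl by (auto simp: cohomologous_via_def)
next
  assume "\<exists>h. cohomologous_via z z' h"
  then obtain h where hl: "linear_map K A M h"
    and h: "\<And>r a b. \<lbrakk>r \<in> U T 2; a \<in> carrier A; b \<in> carrier A\<rbrakk> \<Longrightarrow>
        h (mul r [a, b]) \<oplus>\<^bsub>M\<^esub> z r [a, b] = \<theta>1 r a (h b) \<oplus>\<^bsub>M\<^esub> \<theta>2 r (h a) b \<oplus>\<^bsub>M\<^esub> z' r [a, b]"
    by (auto simp: cohomologous_via_def)
  note hc = linear_map_closed[OF hl]
  let ?\<phi> = "\<lambda>e. enc (pA e, h (pA e) \<oplus>\<^bsub>M\<^esub> pM e)"
  show "equivalent_extensions K T M (ext_of z) (ext_of z')"
  proof (rule equivalent_extensionsI[where \<phi> = ?\<phi>]; unfold ext_of_simps)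
    show "linear_map K E E ?\<phi>"
      by (intro linear_enc linear_map_sum[OF module_M] linear_pA linear_pM linear_map_comp[OF linear_pA hl])
  next
    fix r x y assume r: "r \<in> U T 2" and "x \<in> carrier E" "y \<in> carrier E"
    then obtain a m b n where x: "x = enc (a, m)" "a \<in> carrier A" "m \<in> carrier M"
      and y: "y = enc (b, n)" "b \<in> carrier A" "n \<in> carrier M"
      by (metis enc_cases)
    have zc: "z r [a, b] \<in> carrier M" "z' r [a, b] \<in> carrier M"
      using r x y hom_space_2_closed[OF z] hom_space_2_closed[OF z'] by auto
    have cl: "h (mul r [a, b]) \<in> carrier M" "\<theta>1 r a n \<in> carrier M" "\<theta>2 r m b \<in> carrier M"
      "\<theta>1 r a (h b) \<in> carrier M" "\<theta>2 r (h a) b \<in> carrier M" "mul r [a, b] \<in> carrier A"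
      using r x y hc by (simp_all add: \<theta>1_closed \<theta>2_closed mul_closed)
    \<comment> \<open>The terms in \<open>m\<close> and \<open>n\<close> occur on both sides; once
      they are set apart, the assumption on \<open>h\<close> accounts for the rest.\<close>
    have "h (mul r [a, b]) \<oplus>\<^bsub>M\<^esub> (\<theta>1 r a n \<oplus>\<^bsub>M\<^esub> \<theta>2 r m b \<oplus>\<^bsub>M\<^esub> z r [a, b])
        = (\<theta>1 r a n \<oplus>\<^bsub>M\<^esub> \<theta>2 r m b) \<oplus>\<^bsub>M\<^esub> (h (mul r [a, b]) \<oplus>\<^bsub>M\<^esub> z r [a, b])"
      using cl zc by (simp add: M.a_ac)
    also have "\<dots> = (\<theta>1 r a n \<oplus>\<^bsub>M\<^esub> \<theta>2 r m b) \<oplus>\<^bsub>M\<^esub> (\<theta>1 r a (h b) \<oplus>\<^bsub>M\<^esub> \<theta>2 r (h a) b \<oplus>\<^bsub>M\<^esub> z' r [a, b])"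
      using h[OF r x(2) y(2)] by simp
    also have "\<dots> = \<theta>1 r a (h b \<oplus>\<^bsub>M\<^esub> n) \<oplus>\<^bsub>M\<^esub> \<theta>2 r (h a \<oplus>\<^bsub>M\<^esub> m) b \<oplus>\<^bsub>M\<^esub> z' r [a, b]"
      using cl zc r x y hc by (simp add: \<theta>1_add \<theta>2_add M.a_ac)
    finally show "?\<phi> (tmul z r [x, y]) = tmul z' r [?\<phi> x, ?\<phi> y]"
      using r x y cl zc hc by (simp add: tmul_enc)
  qed (use hc linear_map_zero[OF module_A module_M hl] in simp_all)
qed

text \<open>Applying \<open>\<psi>\<close> carries both composites of \<open>g\<close> to those of
  \<open>\<mu>\<close>, where they agree; injectivity brings the equality back.\<close>

lemma assoc_pullback:
  assumes V: "module K V" and W: "module K W"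
    and g: "g \<in> carrier (hom_space K T 2 V V)" and \<mu>: "\<mu> \<in> carrier (hom_space K T 2 W W)"
    and \<psi>: "linear_map K V W \<psi>" "inj_on \<psi> (carrier V)"
    and mor: "\<And>r x y. \<lbrakk>r \<in> U T 2; x \<in> carrier V; y \<in> carrier V\<rbrakk> \<Longrightarrow> \<psi> (g r [x, y]) = \<mu> r [\<psi> x, \<psi> y]"
    and assoc: "pcomp K T W 2 1 2 \<mu> \<mu> = pcomp K T W 2 2 2 \<mu> \<mu>"
  shows "pcomp K T V 2 1 2 g g = pcomp K T V 2 2 2 g g"
  unfolding pcomp_2_2_eq_iff
proof (intro ballI)
  fix y a b c assume y: "y \<in> U T 3" and a: "a \<in> carrier V" and b: "b \<in> carrier V" and c: "c \<in> carrier V"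
  note R = R_closed_3[OF y]
  note cl = hom_space_2_closed[OF g]
  have L: "lin_ext K V (\<lambda>s. g s [p, q]) x \<in> carrier V"
    "\<psi> (lin_ext K V (\<lambda>s. g s [p, q]) x) = lin_ext K W (\<lambda>s. \<mu> s [\<psi> p, \<psi> q]) x"
    if "x \<in> free_vectors K (U T 2)" "p \<in> carrier V" "q \<in> carrier V" for x p q
  proof -
    have g': "(\<lambda>s. g s [p, q]) \<in> U T 2 \<rightarrow> carrier V"
      using that cl by auto
    show "lin_ext K V (\<lambda>s. g s [p, q]) x \<in> carrier V"
      by (rule lin_ext_in_carrier[OF V that(1) g'])
    have "\<psi> (lin_ext K V (\<lambda>s. g s [p, q]) x) = lin_ext K W (\<lambda>s. \<psi> (g s [p, q])) x"
      by (rule linear_map_lin_ext[OF V W \<psi>(1) that(1) g'])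
    also have "\<dots> = lin_ext K W (\<lambda>s. \<mu> s [\<psi> p, \<psi> q]) x"
      using that mor hom_space_2_closed[OF \<mu>] linear_map_closed[OF \<psi>(1)]
      by (intro lin_ext_cong[OF W that(1)]) auto
    finally show "\<psi> (lin_ext K V (\<lambda>s. g s [p, q]) x) = lin_ext K W (\<lambda>s. \<mu> s [\<psi> p, \<psi> q]) x" .
  qed
  have "\<psi> (g (R0 T 2 1 2 y) [lin_ext K V (\<lambda>s. g s [a, b]) (Rs T 2 1 2 y), c])
      = \<psi> (g (R0 T 2 2 2 y) [a, lin_ext K V (\<lambda>s. g s [b, c]) (Rs T 2 2 2 y)])"
    using assoc[unfolded pcomp_2_2_eq_iff] y a b c R L linear_map_closed[OF \<psi>(1)]
    by (simp add: mor del: One_nat_def)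
  then show "g (R0 T 2 1 2 y) [lin_ext K V (\<lambda>s. g s [a, b]) (Rs T 2 1 2 y), c]
      = g (R0 T 2 2 2 y) [a, lin_ext K V (\<lambda>s. g s [b, c]) (Rs T 2 2 2 y)]"
    using R L a b c cl \<psi>(2) by (simp add: inj_on_eq_iff del: One_nat_def)
qed

text \<open>The cocycle of an extension measures the failure of a linear section to be multiplicative.\<close>

lemma extension_equivalent_ext_of:
  assumes "P \<in> extensions"
  shows "\<exists>z\<in>cocycles. equivalent_extensions K T M (ext_of z) P"
proof -
  have P: "abelian_extension K T A mul M P" and rp: "induces_representation K T A M \<theta>1 \<theta>2 P"
    using assms by (auto simp: extensions_def)
  define V \<mu> i j where Vd: "V = ext_space P" "\<mu> = ext_mult P" "i = ext_incl P" "j = ext_proj P"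
  note p = abelian_extensionD[OF P, folded Vd]
  obtain s where sec: "linear_section K V A j s"
    using p(9) by blast
  then have s: "linear_map K A V s" and js: "\<And>a. a \<in> carrier A \<Longrightarrow> j (s a) = a"
    by (auto simp: linear_section_def)
  have r1: "i (\<theta>1 r a m) = \<mu> r [s a, i m]" and r2: "i (\<theta>2 r m a) = \<mu> r [i m, s a]"
    if "r \<in> U T 2" "a \<in> carrier A" "m \<in> carrier M" for r a m
    using rp sec that unfolding induces_representation_def Vd by blast+
  interpret V: module K V by (rule p(1))
  note sc = linear_map_closed[OF s] and ic = linear_map_closed[OF p(4)] and \<mu>c = hom_space_2_closed[OF p(2)]
  note b\<mu> = hom_space_2_bilinear[OF p(2)]
  define d where "d r a b = \<mu> r [s a, s b] \<oplus>\<^bsub>V\<^esub> \<ominus>\<^bsub>V\<^esub> s (mul r [a, b])" for r a b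
  define z where "z = cochain2 T A (\<lambda>r a b. inv_into (carrier M) i (d r a b))"
  \<comment> \<open>Both terms of \<open>d\<close> lie over \<open>mul r [a, b]\<close>, so
    \<open>j\<close> kills their difference and exactness places it in the image of
    \<open>M\<close>.\<close>
  have d: "d r a b \<in> i ` carrier M" if "r \<in> U T 2" "a \<in> carrier A" "b \<in> carrier A" for r a b
  proof -
    have "j (\<mu> r [s a, s b]) = mul r [a, b]"
      using ext_proj_mult[OF P, folded Vd] that sc js by simp
    then have "j (d r a b) = \<zero>\<^bsub>A\<^esub>"
      unfolding d_def using that sc
      by (simp add: linear_map_add[OF p(5)] linear_map_minus[OF p(1) module_A p(5)] \<mu>c js mul_closed A.r_neg)
    then show ?thesis
      unfolding p(7) using that sc by (simp add: a_kernel_def' d_def \<mu>c mul_closed)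
  qed
  have iz: "z r [a, b] \<in> carrier M" "i (z r [a, b]) = d r a b"
    if "r \<in> U T 2" "a \<in> carrier A" "b \<in> carrier A" for r a b
    using that d[OF that] by (simp_all add: z_def inv_into_into f_inv_into_f)
  have z: "z \<in> carrier (C 2)"
    unfolding z_def
  proof (rule cochain2_in_hom_space[OF module_A])
    fix r assume r: "r \<in> U T 2"
    let ?f = "\<lambda>a b. inv_into (carrier M) i (d r a b)"
    have fc: "?f a b \<in> carrier M" "i (?f a b) = d r a b" if "a \<in> carrier A" "b \<in> carrier A" for a b
      using d[OF r that] by (simp_all add: inv_into_into f_inv_into_f)
    \<comment> \<open>In \<open>V\<close> bilinearity is visible from the formula for
      \<open>d\<close>; \<open>linear_map_lift\<close> transfers it to \<open>M\<close> in each
      argument.\<close>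
    have bd: "bilinear_map K A A V (d r)"
      unfolding d_def
      by (intro bilinear_map_sum[OF p(1)] bilinear_map_uminus[OF p(1)]
            bilinear_map_compose[OF b\<mu>[OF r] s s linear_map_id]
            bilinear_map_compose[OF mul_bilinear[OF r] linear_map_id linear_map_id s])
    show "bilinear_map K A A M ?f"
    proof (rule bilinear_mapI)
      fix a assume a: "a \<in> carrier A"
      show "linear_map K A M (?f a)"
        using a fc
        by (intro linear_map_lift[OF module_A module_M p(4,6)] linear_map_cong[OF module_A bilinear_map_right[OF bd a]])
           auto
      show "linear_map K A M (\<lambda>x. ?f x a)"
        using a fc
        by (intro linear_map_lift[OF module_A module_M p(4,6)] linear_map_cong[OF module_A bilinear_map_left[OF bd a]])
           auto
    qed
  qed
  \<comment> \<open>The splitting of the sequence determined by the section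
    \<open>s\<close>.\<close>
  define \<psi> where "\<psi> x = s (pA x) \<oplus>\<^bsub>V\<^esub> i (pM x)" for x
  have \<psi>l: "linear_map K E V \<psi>"
    unfolding \<psi>_def
    by (intro linear_map_sum[OF p(1)] linear_map_comp[OF linear_pA s] linear_map_comp[OF linear_pM p(4)])
  have \<psi>_enc: "\<psi> (enc (a, m)) = s a \<oplus>\<^bsub>V\<^esub> i m" if "a \<in> carrier A" "m \<in> carrier M" for a m
    using that by (simp add: \<psi>_def)
  have j\<psi>: "j (\<psi> x) = pA x" if "x \<in> carrier E" for x
    using that ext_proj_incl[OF P, folded Vd] sc ic
    by (simp add: \<psi>_def linear_map_add[OF p(5)] js)
  have \<psi>i: "\<psi> (enc (\<zero>\<^bsub>A\<^esub>, m)) = i m" if "m \<in> carrier M" for m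
    using that ic by (simp add: \<psi>_enc linear_map_zero[OF module_A p(1) s])
  have inj: "inj_on \<psi> (carrier E)"
  proof (rule inj_onI)
    fix x y assume x: "x \<in> carrier E" and y: "y \<in> carrier E" and eq: "\<psi> x = \<psi> y"
    then have "pA x = pA y"
      using j\<psi> by metis
    moreover from this have "i (pM x) = i (pM y)"
      using eq x y sc ic by (simp add: \<psi>_def)
    then have "pM x = pM y"
      using p(6) x y by (simp add: inj_on_eq_iff)
    ultimately show "x = y"
      using x y by (simp add: E_eqI)
  qed
  have mor: "\<psi> (tmul z r [x, y]) = \<mu> r [\<psi> x, \<psi> y]"
    if r: "r \<in> U T 2" and "x \<in> carrier E" "y \<in> carrier E" for r x y
  proof -
    from that obtain a m b n where x: "x = enc (a, m)" "a \<in> carrier A" "m \<in> carrier M"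
      and y: "y = enc (b, n)" "b \<in> carrier A" "n \<in> carrier M"
      by (metis enc_cases)
    note c = sc[OF x(2)] sc[OF y(2)] ic[OF x(3)] ic[OF y(3)]
    have cc: "mul r [a, b] \<in> carrier A" "s (mul r [a, b]) \<in> carrier V" "\<mu> r [s a, s b] \<in> carrier V"
      "\<mu> r [s a, i n] \<in> carrier V" "\<mu> r [i m, s b] \<in> carrier V"
      using r x y c sc by (simp_all add: mul_closed \<mu>c)
    \<comment> \<open>Adding \<open>d r a b\<close> turns \<open>s (mul r [a, b])\<close> into
      \<open>\<mu> r [s a, s b]\<close>. The result is the full expansion of the product on the
      right, since its fourth term, the product of \<open>i m\<close> and \<open>i n\<close>, is
      zero.\<close>
    have "\<psi> (tmul z r [x, y]) = s (mul r [a, b]) \<oplus>\<^bsub>V\<^esub> (\<mu> r [s a, i n] \<oplus>\<^bsub>V\<^esub> \<mu> r [i m, s b] \<oplus>\<^bsub>V\<^esub> d r a b)"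
      using r x y iz cc
      by (simp add: tmul_enc \<psi>_enc \<theta>1_closed \<theta>2_closed linear_map_add[OF p(4)] r1 r2)
    also have "\<dots> = \<mu> r [s a, s b] \<oplus>\<^bsub>V\<^esub> \<mu> r [s a, i n] \<oplus>\<^bsub>V\<^esub> \<mu> r [i m, s b]"
    proof -
      have "k \<oplus>\<^bsub>V\<^esub> (p \<oplus>\<^bsub>V\<^esub> q \<oplus>\<^bsub>V\<^esub> (w \<oplus>\<^bsub>V\<^esub> \<ominus>\<^bsub>V\<^esub> k)) = w \<oplus>\<^bsub>V\<^esub> p \<oplus>\<^bsub>V\<^esub> q"
        if "k \<in> carrier V" "p \<in> carrier V" "q \<in> carrier V" "w \<in> carrier V" for k p q w
      proof -
        have "k \<oplus>\<^bsub>V\<^esub> (p \<oplus>\<^bsub>V\<^esub> q \<oplus>\<^bsub>V\<^esub> (w \<oplus>\<^bsub>V\<^esub> \<ominus>\<^bsub>V\<^esub> k)) = w \<oplus>\<^bsub>V\<^esub> p \<oplus>\<^bsub>V\<^esub> q \<oplus>\<^bsub>V\<^esub> (k \<oplus>\<^bsub>V\<^esub> \<ominus>\<^bsub>V\<^esub> k)"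
          using that by (simp add: V.a_ac)
        then show ?thesis
          using that by (simp add: V.r_neg)
      qed
      then show ?thesis
        unfolding d_def using cc by blast
    qed
    also have "\<dots> = \<mu> r [s a \<oplus>\<^bsub>V\<^esub> i m, s b \<oplus>\<^bsub>V\<^esub> i n]"
      using r c cc x y ext_mult_incl_incl[OF P r x(3) y(3), folded Vd]
      by (simp add: linear_map_add[OF bilinear_map_left[OF b\<mu>[OF r]]]
            linear_map_add[OF bilinear_map_right[OF b\<mu>[OF r]]] V.a_ac)
    finally show ?thesis
      using x y by (simp add: \<psi>_enc)
  qed
  \<comment> \<open>Associativity in \<open>V\<close> passes to the twisted product along
    \<open>\<psi>\<close>; by \<open>tmul_assoc_iff\<close> this is the cocycle condition for
    \<open>z\<close>.\<close>
  have "pcomp K T E 2 1 2 (tmul z) (tmul z) = pcomp K T E 2 2 2 (tmul z) (tmul z)"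
    by (rule assoc_pullback[OF module_E p(1) tmul_in[OF z] p(2) \<psi>l inj _ p(3)]) (rule mor)
  then have "z \<in> cocycles"
    using z tmul_assoc_iff[OF z] by (simp add: cocycles_def)
  moreover have "equivalent_extensions K T M (ext_of z) P"
    by (rule equivalent_extensionsI[where \<phi> = \<psi>])
       (simp_all add: \<psi>l mor \<psi>i j\<psi> Vd[symmetric])
  ultimately show ?thesis by blast
qed

text \<open>Both sides are images of \<open>cocycles\<close>, under \<open>?p\<close> and
  \<open>?q\<close>, and these two maps identify the same pairs of cocycles. Sending
  \<open>?p z\<close> to \<open>?q z\<close> is thus well defined and bijective.\<close>

lemma ex_bij_cohomology_Ext:
  "\<exists>\<Phi>. bij_betw \<Phi> (carrier (cohomology K T A mul M \<theta>1 \<theta>2 2)) (Ext K T A mul M \<theta>1 \<theta>2)"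
proof -
  let ?p = "\<lambda>z. coboundaries +>\<^bsub>C 2\<^esub> z" and ?q = "\<lambda>z. equivalence `` {ext_of z}"
  have pq: "?p z = ?p z' \<longleftrightarrow> ?q z = ?q z'" if z: "z \<in> cocycles" "z' \<in> cocycles" for z z'
  proof -
    note e = z[THEN ext_of_in_extensions]
    have "?q z = ?q z' \<longleftrightarrow> equivalent_extensions K T M (ext_of z) (ext_of z')"
      unfolding eq_equiv_class_iff[OF equiv_equivalence e] using e by (simp add: equivalence_def)
    also have "\<dots> \<longleftrightarrow> ?p z = ?p z'"
      using z by (simp add: cocycles_def coset_eq_iff equivalent_ext_of_iff)
    finally show ?thesis by simp
  qed
  have "?q ` cocycles = extensions // equivalence"
  proof (intro equalityI subsetI)
    fix k assume "k \<in> extensions // equivalence"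
    then obtain P where P: "P \<in> extensions" "k = equivalence `` {P}"
      by (auto elim: quotientE)
    then obtain z where z: "z \<in> cocycles" "equivalent_extensions K T M (ext_of z) P"
      using extension_equivalent_ext_of by blast
    then have "(ext_of z, P) \<in> equivalence"
      using P ext_of_in_extensions by (simp add: equivalence_def)
    then have "?q z = k"
      using P equiv_class_eq[OF equiv_equivalence] by blast
    then show "k \<in> ?q ` cocycles"
      using z by blast
  qed (auto intro: quotientI ext_of_in_extensions)
  \<comment> \<open>A representing cocycle is chosen by \<open>inv_into\<close>; by
    \<open>pq\<close> the resulting class does not depend on the choice.\<close>
  moreover have "bij_betw (\<lambda>k. ?q (inv_into cocycles ?p k)) (?p ` cocycles) (?q ` cocycles)"
    unfolding bij_betw_def
  proof (intro conjI inj_onI)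
    fix k l assume k: "k \<in> ?p ` cocycles" and l: "l \<in> ?p ` cocycles"
      and "?q (inv_into cocycles ?p k) = ?q (inv_into cocycles ?p l)"
    then have "?p (inv_into cocycles ?p k) = ?p (inv_into cocycles ?p l)"
      using pq by (meson inv_into_into)
    then show "k = l"
      using k l by (simp add: f_inv_into_f)
  next
    have "?q (inv_into cocycles ?p (?p z)) = ?q z" if z: "z \<in> cocycles" for z
    proof -
      have "?p z \<in> ?p ` cocycles"
        using z by (rule imageI)
      then have "inv_into cocycles ?p (?p z) \<in> cocycles" "?p (inv_into cocycles ?p (?p z)) = ?p z"
        by (rule inv_into_into, rule f_inv_into_f)
      then show ?thesis
        using pq[of "inv_into cocycles ?p (?p z)" z] z by blast
    qed
    then show "(\<lambda>k. ?q (inv_into cocycles ?p k)) ` (?p ` cocycles) = ?q ` cocycles"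
      by (simp add: image_image)
  qed
  ultimately show ?thesis
    unfolding carrier_cohomology_2 Ext_eq by metis
qed

end

section \<open>Room for the direct sum in the universe\<close>

lemma infinite_carrier_module:
  assumes K: "field_char0 K" and V: "module K V" and v: "v \<in> carrier V" "v \<noteq> \<zero>\<^bsub>V\<^esub>"
  shows "infinite (carrier V)"
proof -
  interpret K: field K using K by (simp add: field_char0_def)
  interpret V: module K V by fact
  let ?c = "\<lambda>n::nat. [n] \<cdot>\<^bsub>K\<^esub> \<one>\<^bsub>K\<^esub>"
  \<comment> \<open>If two multiples of \<open>v\<close> agreed, \<open>n - m\<close> times
    \<open>v\<close> would be zero; but \<open>n - m\<close> is invertible in characteristic
    0.\<close>
  have "(\<lambda>n. ?c n \<odot>\<^bsub>V\<^esub> v) n \<noteq> (\<lambda>n. ?c n \<odot>\<^bsub>V\<^esub> v) m" if "m < n" for m n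
  proof
    assume eq: "?c n \<odot>\<^bsub>V\<^esub> v = ?c m \<odot>\<^bsub>V\<^esub> v"
    let ?k = "?c (n - m)"
    have k: "?k \<in> carrier K" "?k \<noteq> \<zero>\<^bsub>K\<^esub>"
      using K that by (auto simp: field_char0_def)
    have "?c n = ?c m \<oplus>\<^bsub>K\<^esub> ?k"
      using that K.add.nat_pow_mult[of "\<one>\<^bsub>K\<^esub>" m "n - m"] by simp
    then have "?c m \<odot>\<^bsub>V\<^esub> v \<oplus>\<^bsub>V\<^esub> ?k \<odot>\<^bsub>V\<^esub> v = ?c m \<odot>\<^bsub>V\<^esub> v"
      using eq k v by (simp add: V.smult_l_distr)
    then have "?k \<odot>\<^bsub>V\<^esub> v = \<zero>\<^bsub>V\<^esub>"
      using k v by simp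
    moreover have "inv\<^bsub>K\<^esub> ?k \<odot>\<^bsub>V\<^esub> (?k \<odot>\<^bsub>V\<^esub> v) = v"
      using k v by (simp add: V.smult_assoc1[symmetric] K.field_Units)
    ultimately show False
      using k v by (simp add: K.field_Units)
  qed
  then have "inj (\<lambda>n. ?c n \<odot>\<^bsub>V\<^esub> v)"
    by (intro linorder_injI) metis
  moreover have "range (\<lambda>n. ?c n \<odot>\<^bsub>V\<^esub> v) \<subseteq> carrier V"
    using v by auto
  ultimately show ?thesis
    using infinite_super range_inj_infinite by blast
qed

text \<open>The case distinction is on the universe: an infinite type is equipotent with its square,
  and a finite one has room only for the zero space.\<close>

lemma ex_inj_on_Times:
  fixes A M :: "('k, 'u) module"
  assumes K: "field_char0 K" and A: "module K A" and M: "module K M"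
  shows "\<exists>enc :: 'u \<times> 'u \<Rightarrow> 'u. inj_on enc (carrier A \<times> carrier M)"
proof (cases "infinite (UNIV :: 'u set)")
  case True
  have "|UNIV \<times> UNIV :: ('u \<times> 'u) set| \<le>o |UNIV :: 'u set|"
    using card_of_Times_same_infinite[OF True] ordIso_iff_ordLeq by blast
  then obtain enc :: "'u \<times> 'u \<Rightarrow> 'u" where "inj_on enc (UNIV \<times> UNIV)"
    using card_of_ordLeq[of "UNIV \<times> UNIV :: ('u \<times> 'u) set" "UNIV :: 'u set"] by auto
  then have "inj_on enc (carrier A \<times> carrier M)"
    by (rule inj_on_subset) simp
  then show ?thesis by (intro exI[of _ enc])
next
  case False
  then have fin: "finite V" for V :: "'u set"
    using finite_subset[OF subset_UNIV] by blast
  \<comment> \<open>A nonzero vector would make the carrier infinite. So \<open>M\<close> is zero,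
    and the first projection already codes the pairs.\<close>
  have "a = \<zero>\<^bsub>M\<^esub>" if "a \<in> carrier M" for a
    using that infinite_carrier_module[OF K M, of a] fin[of "carrier M"] by metis
  then have "inj_on fst (carrier A \<times> carrier M)"
    by (auto simp: inj_on_def)
  then show ?thesis by (intro exI[of _ fst])
qed

theorem theorem5p8:
  fixes K :: "'k ring"
    and T :: "('r, 'k) type_data"
    and A M :: "('k, 'u) module"
    and mul :: "'r \<Rightarrow> 'u list \<Rightarrow> 'u"
    and \<theta>1 \<theta>2 :: "'r \<Rightarrow> 'u \<Rightarrow> 'u \<Rightarrow> 'u"
  assumes "field_char0 K"
    and "loday_type TYPE('u) K T"
    and U1_singleton: "card (U T 1) = 1"
    and "loday_algebra K T A mul"
    and "loday_representation K T A mul M \<theta>1 \<theta>2"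
  shows "\<exists>\<Phi>. bij_betw \<Phi> (carrier (cohomology K T A mul M \<theta>1 \<theta>2 2)) (Ext K T A mul M \<theta>1 \<theta>2)"
proof -
  have A: "module K A" and M: "module K M"
    using assms(4,5) by (simp_all add: loday_algebra_def loday_representation_def)
  \<comment> \<open>Any coding serves, as the conclusion does not mention it.\<close>
  obtain enc :: "'u \<times> 'u \<Rightarrow> 'u" where "inj_on enc (carrier A \<times> carrier M)"
    using ex_inj_on_Times[OF assms(1) A M] by blast
  then interpret loday_module K A M enc T mul \<theta>1 \<theta>2
    using A M assms by (intro loday_module.intro module_sum.intro loday_module_axioms.intro)
  show ?thesis
    by (rule ex_bij_cohomology_Ext)
qed

end
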